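(* For every integer $c\ge 4$, the chromatic symmetric function of $H_c$ satisfies $$\mathbf{X}_{H_c}=\mathbf{X}_{A_c}-\mathbf{X}_{B_c}+\mathbf{X}_{T_c}-\mathbf{X}_{S_c}+\mathbf{X}_{F_c}+\sum_{i=1}^{c-4}\Big(\mathbf{X}_{[(2^i,3)]\sqcup[(2^{c-3-i},3,2^{c-2})]}-\mathbf{X}_{[(2^{i+1})]\sqcup[(3,2^{c-4-i},3,2^{c-2})]}\Big).$$ Hence $\mathbf{X}_{G_c}=\mathbf{X}_{H_c}$.
   Context: All graphs are finite and simple. The chromatic symmetric function (CSF) of a graph $G$ with vertex set $V=\{v_1,\dots,v_n\}$ is $\mathbf{X}_G=\sum_{\kappa}x_{\kappa(v_1)}\cdots x_{\kappa(v_n)}$, where $\kappa:V\to\mathbb{N}$ ranges over all proper colorings of $G$ and $x_i$ ($i\in\mathbb{N}$) are commuting variables. Caterpillar notation: for a composition (nonempty finite sequence of positive integers) $\alpha=(\alpha_1,\dots,\alpha_\ell)$, $[\alpha]$ denotes the graph consisting of a path $v_1,\dots,v_\ell$ (the spine) together with $\alpha_i-1$ additional leaves attached to $v_i$ for each $i$. So $[(1)]$ is a single vertex, and $[\alpha]$ is isomorphic to $[\alpha^*]$ with $\alpha^*=(\alpha_\ell,\dots,\alpha_1)$. Inside a composition, $m^k$ means $k$ consecutive entries equal to $m$ (no entries if $k=0$). $\sqcup$ denotes disjoint union of graphs. Empty sums are $0$. Fix $c\ge4$. Start from $[(2^{c-1})]\sqcup[(2^{c-1})]$, with "left" spine vertices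 $v_1^L,\dots,v_{c-1}^L$ and "right" spine vertices $v_1^R,\dots,v_{c-1}^R$ (consecutive ones adjacent in each), and with $f_i^L$, $f_i^R$ the leaf attached to $v_i^L$, $v_i^R$ respectively. - $G_c$: add the edges $\{v_{c-1}^L,v_1^R\}$ and $\{f_2^L,v_1^R\}$. - $H_c$: add the edges $\{v_{c-1}^L,f_1^R\}$ and $\{v_2^L,v_1^R\}$. - $A_c$: add the edges $\{v_2^L,v_1^R\}$ and $\{v_{c-1}^L,v_1^R\}$. - $B_c$: obtained from $A_c$ by deleting the edge $\{v_2^L,f_2^L\}$ (keeping all vertices). Also $T_c=[(2^{c-2},1,3,2^{c-2})]$, $S_c=[(2^{c-2})]\sqcup[(4,2^{c-2})]$, $F_c=[(3)]\sqcup[(2^{c-3},3,2^{c-2})]$. *)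

theory Defs
  imports "HOL-Library.Multiset" "HOL-Library.FuncSet" "HOL-Library.Function_Algebras"
begin

section \<open>Finite simple graphs\<close>

record 'a ugraph =
  verts :: "'a set"
  edges :: "'a set set"

definition fin_simple_graph :: "'a ugraph \<Rightarrow> bool" where
  "fin_simple_graph G \<longleftrightarrow>
     finite (verts G) \<and> (\<forall>e \<in> edges G. e \<subseteq> verts G \<and> card e = 2)"

definition add_edges :: "'a ugraph \<Rightarrow> 'a set set \<Rightarrow> 'a ugraph" where
  "add_edges G F = \<lparr>verts = verts G, edges = edges G \<union> F\<rparr>"

definition del_edge :: "'a ugraph \<Rightarrow> 'a set \<Rightarrow> 'a ugraph" where
  "del_edge G e = \<lparr>verts = verts G, edges = edges G - {e}\<rparr>"

definition disj_union :: "'a ugraph \<Rightarrow> 'b ugraph \<Rightarrow> ('a + 'b) ugraph" (infixl "\<squnion>\<^sub>g" 65) where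
  "G \<squnion>\<^sub>g H = \<lparr>verts = verts G <+> verts H,
              edges = ((`) Inl) ` edges G \<union> ((`) Inr) ` edges H\<rparr>"

section \<open>Chromatic symmetric functions\<close>

definition proper_colorings :: "'a ugraph \<Rightarrow> ('a \<Rightarrow> nat) set" where
  "proper_colorings G =
     {\<kappa> \<in> verts G \<rightarrow>\<^sub>E UNIV. \<forall>u v. {u, v} \<in> edges G \<longrightarrow> \<kappa> u \<noteq> \<kappa> v}"

text \<open>
  A formal power series with integer coefficients in the commuting variables $x_0, x_1, \ldots$
  is given by its coefficients. The monomial $x_{i_1} \cdots x_{i_n}$ is the multiset of its
  indices, so a power series is a function from multisets to integers. Sums and differences of
  such series are the pointwise ones of Function\_Algebras; the pointwise product there is
  not the product of power series and is not used.
\<close>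

type_synonym power_series = "nat multiset \<Rightarrow> int"

definition coloring_monomial :: "'a ugraph \<Rightarrow> ('a \<Rightarrow> nat) \<Rightarrow> nat multiset" where
  "coloring_monomial G \<kappa> = image_mset \<kappa> (mset_set (verts G))"

definition csf :: "'a ugraph \<Rightarrow> power_series" where
  "csf G = (\<lambda>m. int (card {\<kappa> \<in> proper_colorings G. coloring_monomial G \<kappa> = m}))"

text \<open>The cardinality above is that of a finite set.\<close>

lemma finite_colorings_with_monomial:
  assumes "finite (verts G)"
  shows "finite {\<kappa> \<in> proper_colorings G. coloring_monomial G \<kappa> = m}"
proof (rule finite_subset)
  show "{\<kappa> \<in> proper_colorings G. coloring_monomial G \<kappa> = m} \<subseteq> verts G \<rightarrow>\<^sub>E set_mset m"
  proof
    fix \<kappa> assume "\<kappa> \<in> {\<kappa> \<in> proper_colorings G. coloring_monomial G \<kappa> = m}"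
    then have k: "\<kappa> \<in> verts G \<rightarrow>\<^sub>E UNIV" and m: "set_mset m = \<kappa> ` verts G"
      using assms by (auto simp: proper_colorings_def coloring_monomial_def)
    then show "\<kappa> \<in> verts G \<rightarrow>\<^sub>E set_mset m" by (auto simp: PiE_iff)
  qed
  show "finite (verts G \<rightarrow>\<^sub>E set_mset m)" using assms by (intro finite_PiE) auto
qed

section \<open>Caterpillars\<close>

text \<open>
  The spine vertex $v_i$ ($1 \le i \le \ell$) is \<open>(i, 0)\<close>, and \<open>(i, j)\<close> with
  $1 \le j < \alpha_i$ are the leaves attached to it. List positions start at 0, so $\alpha_i$
  is \<open>\<alpha> ! (i - 1)\<close>. The lists are meant to be compositions, that is, nonempty lists of
  positive numbers.
\<close>

definition caterpillar :: "nat list \<Rightarrow> (nat \<times> nat) ugraph" where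
  "caterpillar \<alpha> =
     \<lparr>verts = {(i, j) |i j. 1 \<le> i \<and> i \<le> length \<alpha> \<and> j < \<alpha> ! (i - 1)},
      edges = {{(i, 0), (i + 1, 0)} |i. 1 \<le> i \<and> i < length \<alpha>}
            \<union> {{(i, 0), (i, j)} |i j. 1 \<le> i \<and> i \<le> length \<alpha> \<and> 1 \<le> j \<and> j < \<alpha> ! (i - 1)}\<rparr>"

section \<open>The particular graphs\<close>

type_synonym two_cat_vertex = "(nat \<times> nat) + (nat \<times> nat)"

definition vL :: "nat \<Rightarrow> two_cat_vertex" where "vL i = Inl (i, 0)"
definition vR :: "nat \<Rightarrow> two_cat_vertex" where "vR i = Inr (i, 0)"
definition fL :: "nat \<Rightarrow> two_cat_vertex" where "fL i = Inl (i, 1)"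
definition fR :: "nat \<Rightarrow> two_cat_vertex" where "fR i = Inr (i, 1)"

definition base_graph :: "nat \<Rightarrow> two_cat_vertex ugraph" where
  "base_graph c = caterpillar (replicate (c - 1) 2) \<squnion>\<^sub>g caterpillar (replicate (c - 1) 2)"

definition G_graph :: "nat \<Rightarrow> two_cat_vertex ugraph" where
  "G_graph c = add_edges (base_graph c) {{vL (c - 1), vR 1}, {fL 2, vR 1}}"

definition H_graph :: "nat \<Rightarrow> two_cat_vertex ugraph" where
  "H_graph c = add_edges (base_graph c) {{vL (c - 1), fR 1}, {vL 2, vR 1}}"

definition A_graph :: "nat \<Rightarrow> two_cat_vertex ugraph" where
  "A_graph c = add_edges (base_graph c) {{vL 2, vR 1}, {vL (c - 1), vR 1}}"

definition B_graph :: "nat \<Rightarrow> two_cat_vertex ugraph" where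
  "B_graph c = del_edge (A_graph c) {vL 2, fL 2}"

definition T_graph :: "nat \<Rightarrow> (nat \<times> nat) ugraph" where
  "T_graph c = caterpillar (replicate (c - 2) 2 @ [1, 3] @ replicate (c - 2) 2)"

definition S_graph :: "nat \<Rightarrow> two_cat_vertex ugraph" where
  "S_graph c = caterpillar (replicate (c - 2) 2) \<squnion>\<^sub>g caterpillar ([4] @ replicate (c - 2) 2)"

definition F_graph :: "nat \<Rightarrow> two_cat_vertex ugraph" where
  "F_graph c = caterpillar [3] \<squnion>\<^sub>g
     caterpillar (replicate (c - 3) 2 @ [3] @ replicate (c - 2) 2)"

section \<open>All graphs involved are finite and simple\<close>

lemma fin_simple_graph_caterpillar:
  assumes "\<forall>a \<in> set \<alpha>. 1 \<le> a"
  shows "fin_simple_graph (caterpillar \<alpha>)"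
proof -
  have pos: "0 < \<alpha> ! (i - Suc 0)" if "Suc 0 \<le> i" "i \<le> length \<alpha>" for i
    using assms that nth_mem[of "i - Suc 0" \<alpha>] by fastforce
  have pos': "0 < \<alpha> ! i" if "i < length \<alpha>" for i
    using assms that nth_mem[of i \<alpha>] by fastforce
  have "verts (caterpillar \<alpha>) = (SIGMA i:{1..length \<alpha>}. {..<\<alpha> ! (i - 1)})"
    by (auto simp: caterpillar_def)
  then have "finite (verts (caterpillar \<alpha>))" by simp
  then show ?thesis
    by (auto simp: fin_simple_graph_def caterpillar_def card_insert_if pos pos')
qed

lemma fin_simple_graph_disj_union:
  assumes "fin_simple_graph G" "fin_simple_graph H"
  shows "fin_simple_graph (G \<squnion>\<^sub>g H)"
  using assms by (auto simp: fin_simple_graph_def disj_union_def card_image)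

lemma fin_simple_graph_special:
  assumes "c \<ge> 4"
  shows "fin_simple_graph (G_graph c)" "fin_simple_graph (H_graph c)"
    "fin_simple_graph (A_graph c)" "fin_simple_graph (B_graph c)"
    "fin_simple_graph (T_graph c)" "fin_simple_graph (S_graph c)" "fin_simple_graph (F_graph c)"
proof -
  have base: "fin_simple_graph (base_graph c)"
    unfolding base_graph_def
    by (intro fin_simple_graph_disj_union fin_simple_graph_caterpillar) auto
  have mem: "vL i \<in> verts (base_graph c)" "vR i \<in> verts (base_graph c)"
    "fL i \<in> verts (base_graph c)" "fR i \<in> verts (base_graph c)" if "1 \<le> i" "i \<le> c - 1" for i
    using that
    by (auto simp: base_graph_def disj_union_def caterpillar_def vL_def vR_def fL_def fR_def)
  have add: "fin_simple_graph (add_edges (base_graph c) F)"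
    if "\<forall>e\<in>F. e \<subseteq> verts (base_graph c) \<and> card e = 2" for F
    using base that by (auto simp: fin_simple_graph_def add_edges_def)
  have ne: "vL i \<noteq> vR j" "fL i \<noteq> vR j" "vL i \<noteq> fR j" for i j
    by (auto simp: vL_def vR_def fL_def fR_def)
  show "fin_simple_graph (G_graph c)" "fin_simple_graph (H_graph c)"
    unfolding G_graph_def H_graph_def using assms by (auto intro!: add mem simp: ne)
  show A: "fin_simple_graph (A_graph c)"
    unfolding A_graph_def using assms by (auto intro!: add mem simp: ne)
  then show "fin_simple_graph (B_graph c)"
    by (auto simp: B_graph_def del_edge_def fin_simple_graph_def)
  show "fin_simple_graph (T_graph c)" "fin_simple_graph (S_graph c)" "fin_simple_graph (F_graph c)"
    unfolding T_graph_def S_graph_def F_graph_def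
    by (intro fin_simple_graph_disj_union fin_simple_graph_caterpillar; auto)+
qed

end

theory Submission
  imports Defs "HOL-Library.Poly_Mapping"
begin

text \<open>
  If $b c$ is an edge, moving an edge $a b$ to $a c$ changes the chromatic symmetric function by the
  difference of the two graphs in which $b c$ is deleted. One such move gives
  $X_G = X_A - X_B + X_{[(2,1,2^{c-3},3,2^{c-2})]}$; sliding the entry 1 in this caterpillar to the
  right, one leaf at a time, produces the asserted expansion. For $H_c$ the same move, applied three
  times, gives $X_H = X_A - X_B$ plus products of caterpillars. It remains to see an identity between
  caterpillars, which follows by sliding entries 1 and 3 along runs of 2 until reversal identifies
  the two ends.
\<close>

section \<open>Caterpillar sums\<close>

text \<open>Disjoint unions call for products, but the pointwise product on the type of power series
  is the wrong one. Hence a finite set of colors with weights in an arbitrary commutative ring: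
  disjoint union becomes multiplication there, and the claim turns into ring identities.
  Caterpillars are treated as lists, through sums refined by the color of the first spine vertex;
  graphs enter only to locate a few forests inside the base graph. \<open>A\<close> and
  \<open>B\<close> contain a cycle and are never evaluated; they only have to occur with the same
  coefficients for \<open>G\<close> and \<open>H\<close>. In \<open>H\<close> the edge from
  \<open>vL (c - 1)\<close> to \<open>fR 1\<close> is moved to \<open>vR 1\<close>, which gives
  \<open>A\<close>, but neither remainder is a product of caterpillars: in one, \<open>vL 2\<close>
  carries three branches longer than a leaf; in the other, a cycle survives. The second and third
  move repair this.\<close>

locale color_weights =
  fixes C :: "nat set" and x :: "nat \<Rightarrow> 'r::comm_ring_1"
  assumes finite_C: "finite C"
begin

definition total :: 'r where "total = (\<Sum>k\<in>C. x k)"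

text \<open>
  \<open>cat_rsum \<alpha> k\<close> is the weighted number of proper colorings of the caterpillar $[\alpha]$ in which the first
  spine vertex has color \<open>k\<close>; each leaf at that vertex contributes a factor \<open>total - x k\<close>.
  The truncated subtraction makes it count an entry 0 like an entry 1.
\<close>

fun cat_rsum :: "nat list \<Rightarrow> nat \<Rightarrow> 'r" where
  "cat_rsum [] k = 0"
| "cat_rsum (a # \<alpha>) k =
     x k * (total - x k) ^ (a - 1) * (if \<alpha> = [] then 1 else (\<Sum>l\<in>C. cat_rsum \<alpha> l) - cat_rsum \<alpha> k)"

definition cat_csum :: "nat list \<Rightarrow> 'r" where "cat_csum \<alpha> = (\<Sum>k\<in>C. cat_rsum \<alpha> k)"

lemma cat_rsum_Suc: "0 < a \<Longrightarrow> cat_rsum (Suc a # \<alpha>) k = (total - x k) * cat_rsum (a # \<alpha>) k"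
  by (cases a) (auto simp: algebra_simps)

lemma cat_rsum_Cons: "\<alpha> \<noteq> [] \<Longrightarrow> cat_rsum (a # \<alpha>) k = x k * (total - x k) ^ (a - 1) * (cat_csum \<alpha> - cat_rsum \<alpha> k)"
  by (simp add: cat_csum_def)

lemma cat_rsum_single: "cat_rsum [a] k = x k * (total - x k) ^ (a - 1)"
  by simp

lemma cat_csum_Cons: "\<alpha> \<noteq> [] \<Longrightarrow> cat_csum (a # \<alpha>) = (\<Sum>k\<in>C. x k * (total - x k) ^ (a - 1) * (cat_csum \<alpha> - cat_rsum \<alpha> k))"
  unfolding cat_csum_def[of "a # \<alpha>"] by (rule sum.cong[OF refl cat_rsum_Cons])

lemmas [simp del] = cat_rsum.simps(2)

text \<open>This is triple deletion with the spine edge between the two entries in the role of the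
  deleted edge. For empty \<alpha> the terms in \<open>cat_rsum (b # \<beta>) k\<close> cancel,
  since the factor \<open>total - x k\<close> gained on one side by \<open>Suc a\<close> is gained
  on the other by \<open>Suc b\<close>; the separated pieces remain. A longer prefix acts on all
  terms by the same linear recursion. The piece with the root keeps its color \<open>k\<close>, the
  other is summed over all colors.\<close>

lemma cat_rsum_leaf_move:
  assumes "0 < a" "0 < b"
  shows "cat_rsum (\<alpha> @ Suc a # b # \<beta>) k =
    cat_rsum (\<alpha> @ a # Suc b # \<beta>) k + cat_rsum (\<alpha> @ [Suc a]) k * cat_csum (b # \<beta>) - cat_rsum (\<alpha> @ [a]) k * cat_csum (Suc b # \<beta>)"
proof (induction \<alpha> arbitrary: k)
  case Nil
  obtain a' where a': "a = Suc a'" using assms(1) by (cases a) auto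
  have 1: "cat_rsum (Suc a # b # \<beta>) k = x k * (total - x k) ^ a * (cat_csum (b # \<beta>) - cat_rsum (b # \<beta>) k)"
    by (subst cat_rsum_Cons) auto
  have 2: "cat_rsum (a # Suc b # \<beta>) k = x k * (total - x k) ^ (a - 1) * (cat_csum (Suc b # \<beta>) - (total - x k) * cat_rsum (b # \<beta>) k)"
    by (subst cat_rsum_Cons) (auto simp only: cat_rsum_Suc[OF assms(2)])
  show ?case unfolding append_Nil 1 2 cat_rsum_single by (simp add: a' algebra_simps)
next
  case (Cons c \<alpha>)
  have cat_csum: "cat_csum (\<alpha> @ Suc a # b # \<beta>) =
    cat_csum (\<alpha> @ a # Suc b # \<beta>) + cat_csum (\<alpha> @ [Suc a]) * cat_csum (b # \<beta>) - cat_csum (\<alpha> @ [a]) * cat_csum (Suc b # \<beta>)"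
    by (simp add: cat_csum_def[of "\<alpha> @ _"] Cons.IH sum.distrib sum_subtractf sum_distrib_right)
  show ?case
    by (simp add: cat_rsum_Cons cat_csum Cons.IH algebra_simps)
qed

lemma cat_csum_leaf_move:
  assumes "0 < a" "0 < b"
  shows "cat_csum (\<alpha> @ Suc a # b # \<beta>) =
    cat_csum (\<alpha> @ a # Suc b # \<beta>) + cat_csum (\<alpha> @ [Suc a]) * cat_csum (b # \<beta>) - cat_csum (\<alpha> @ [a]) * cat_csum (Suc b # \<beta>)"
  by (simp add: cat_csum_def[of "\<alpha> @ _"] cat_rsum_leaf_move[OF assms] sum.distrib sum_subtractf sum_distrib_right)

text \<open>A last spine vertex without leaves is itself a leaf of the vertex before it.\<close>

lemma cat_rsum_snoc_1:
  assumes "0 < a"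
  shows "k \<in> C \<Longrightarrow> cat_rsum (\<alpha> @ [a, 1]) k = cat_rsum (\<alpha> @ [Suc a]) k"
proof (induction \<alpha> arbitrary: k)
  case Nil
  obtain a' where a': "a = Suc a'" using assms(1) by (cases a) auto
  show ?case by (simp add: a' cat_rsum.simps(2) total_def[symmetric])
next
  case (Cons c \<alpha>)
  then show ?case by (simp add: cat_rsum.simps(2))
qed

lemma cat_csum_snoc_1: "0 < a \<Longrightarrow> cat_csum (\<alpha> @ [a, 1]) = cat_csum (\<alpha> @ [Suc a])"
  unfolding cat_csum_def by (intro sum.cong refl cat_rsum_snoc_1)

text \<open>At the front the root changes from the end vertex to its neighbor, so only the sums over
  all root colors agree: the end vertex contributes \<open>total - x k\<close> when its neighbor has
  color \<open>k\<close>.\<close>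

lemma cat_csum_Cons_1:
  assumes "0 < a"
  shows "cat_csum (1 # a # \<alpha>) = cat_csum (Suc a # \<alpha>)"
proof -
  have "cat_csum (1 # a # \<alpha>) = (\<Sum>k\<in>C. x k * (cat_csum (a # \<alpha>) - cat_rsum (a # \<alpha>) k))"
    by (simp add: cat_csum_Cons)
  also have "\<dots> = total * cat_csum (a # \<alpha>) - (\<Sum>k\<in>C. x k * cat_rsum (a # \<alpha>) k)"
    by (simp add: right_diff_distrib sum_subtractf total_def sum_distrib_right)
  also have "\<dots> = (\<Sum>k\<in>C. (total - x k) * cat_rsum (a # \<alpha>) k)"
    by (simp add: algebra_simps sum_subtractf cat_csum_def sum_distrib_left)
  also have "\<dots> = cat_csum (Suc a # \<alpha>)" unfolding cat_csum_def by (rule sum.cong[OF refl cat_rsum_Suc[OF assms, symmetric]])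
  finally show ?thesis .
qed

text \<open>
  The right-hand side is symmetric and stays unchanged when the first entry of \<open>\<alpha>\<close> is moved to
  \<open>\<beta>\<close>, because multiplication by the weight of an entry is self-adjoint.
\<close>

lemma cat_csum_rev_append:
  assumes "\<alpha> \<noteq> []" "\<beta> \<noteq> []"
  shows "cat_csum (rev \<alpha> @ \<beta>) = cat_csum \<alpha> * cat_csum \<beta> - (\<Sum>k\<in>C. cat_rsum \<alpha> k * cat_rsum \<beta> k)"
  using assms
proof (induction \<alpha> arbitrary: \<beta>)
  case Nil then show ?case by simp
next
  case (Cons a \<alpha>)
  let ?w = "\<lambda>k. x k * (total - x k) ^ (a - 1)"
  note \<beta> = cat_csum_Cons[OF Cons.prems(2), of a]
  show ?case
  proof (cases "\<alpha> = []")
    case True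
    have "cat_csum (a # \<beta>) = cat_csum [a] * cat_csum \<beta> - (\<Sum>k\<in>C. cat_rsum [a] k * cat_rsum \<beta> k)"
      unfolding \<beta> by (simp add: cat_csum_def[of "[a]"] cat_rsum_single right_diff_distrib sum_subtractf sum_distrib_right)
    then show ?thesis by (simp only: True rev.simps append_Nil append_Cons)
  next
    case False
    note \<alpha> = cat_csum_Cons[OF False, of a]
    have "cat_csum (rev (a # \<alpha>) @ \<beta>) = cat_csum \<alpha> * cat_csum (a # \<beta>) - (\<Sum>k\<in>C. cat_rsum \<alpha> k * cat_rsum (a # \<beta>) k)"
      using Cons.IH[OF False, of "a # \<beta>"] by simp
    also have "\<dots> = (\<Sum>k\<in>C. ?w k * (cat_csum \<alpha> - cat_rsum \<alpha> k) * (cat_csum \<beta> - cat_rsum \<beta> k))"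
      unfolding \<beta> cat_rsum_Cons[OF Cons.prems(2)] sum_distrib_left sum_subtractf[symmetric]
      by (rule sum.cong) (simp_all add: algebra_simps)
    also have "\<dots> = cat_csum (a # \<alpha>) * cat_csum \<beta> - (\<Sum>k\<in>C. cat_rsum (a # \<alpha>) k * cat_rsum \<beta> k)"
      unfolding \<alpha> cat_rsum_Cons[OF False] sum_distrib_right sum_subtractf[symmetric]
      by (rule sum.cong) (simp_all add: algebra_simps)
    finally show ?thesis .
  qed
qed

text \<open>The formula for a join is symmetric in its two halves; with \<open>[a]\<close> as one
  half it gives the reversal without an induction.\<close>

lemma cat_csum_rev: "cat_csum (rev \<alpha>) = cat_csum \<alpha>"
proof (cases \<alpha>)
  case Nil
  then show ?thesis by simp
next
  case [simp]: (Cons a \<alpha>')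
  show ?thesis
  proof (cases "\<alpha>' = []")
    case True
    then show ?thesis by simp
  next
    case False
    have "cat_csum (rev \<alpha>) = cat_csum (rev \<alpha>' @ [a])" by simp
    also have "\<dots> = cat_csum (rev [a] @ \<alpha>')"
      using False by (simp only: cat_csum_rev_append list.distinct mult.commute simp_thms not_Cons_self2)
    finally show ?thesis by simp
  qed
qed

section \<open>Sliding an entry along a run of 2s\<close>

abbreviation twos :: "nat \<Rightarrow> nat list" where "twos k \<equiv> replicate k 2"

text \<open>Exchanging 1, 2 for 2, 1 moves a leaf to the left, so the leaf move with
  \<open>a = b = 1\<close> is read backwards. Each exchange adds one difference of products;
  \<open>i\<close> counts the 2s already passed, which the induction absorbs into \<alpha>.\<close>

lemma slide_1:
  "cat_csum (\<alpha> @ 1 # twos k @ \<beta>) = cat_csum (\<alpha> @ twos k @ 1 # \<beta>) +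
     (\<Sum>i<k. cat_csum (\<alpha> @ twos i @ [1]) * cat_csum (twos (k - i) @ \<beta>)
           - cat_csum (\<alpha> @ twos (Suc i)) * cat_csum (1 # twos (k - Suc i) @ \<beta>))"
proof (induction k arbitrary: \<alpha>)
  case 0
  then show ?case by simp
next
  case (Suc k)
  have "cat_csum (\<alpha> @ 1 # twos (Suc k) @ \<beta>) =
    cat_csum ((\<alpha> @ [2]) @ 1 # twos k @ \<beta>) + cat_csum (\<alpha> @ [1]) * cat_csum (twos (Suc k) @ \<beta>) - cat_csum (\<alpha> @ [2]) * cat_csum (1 # twos k @ \<beta>)"
    using cat_csum_leaf_move[of 1 1 \<alpha> "twos k @ \<beta>"] by (simp add: numeral_2_eq_2)
  then show ?case
    unfolding Suc.IH sum.lessThan_Suc_shift by (simp add: algebra_simps)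
qed

text \<open>Exchanging 3, 2 for 2, 3 moves a leaf to the right, so here the leaf move is read
  forwards.\<close>

lemma slide_3:
  "cat_csum (\<alpha> @ 3 # twos k @ \<beta>) = cat_csum (\<alpha> @ twos k @ 3 # \<beta>) +
     (\<Sum>i<k. cat_csum (\<alpha> @ twos i @ [3]) * cat_csum (twos (k - i) @ \<beta>)
           - cat_csum (\<alpha> @ twos (Suc i)) * cat_csum (3 # twos (k - Suc i) @ \<beta>))"
proof (induction k arbitrary: \<alpha>)
  case 0
  then show ?case by simp
next
  case (Suc k)
  have "cat_csum (\<alpha> @ 3 # twos (Suc k) @ \<beta>) =
    cat_csum ((\<alpha> @ [2]) @ 3 # twos k @ \<beta>) + cat_csum (\<alpha> @ [3]) * cat_csum (twos (Suc k) @ \<beta>) - cat_csum (\<alpha> @ [2]) * cat_csum (3 # twos k @ \<beta>)"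
    using cat_csum_leaf_move[of 2 2 \<alpha> "twos k @ \<beta>"] by (simp add: numeral_3_eq_3)
  then show ?case
    unfolding Suc.IH sum.lessThan_Suc_shift by (simp add: algebra_simps)
qed

text \<open>The following end rules normalize the pieces cut off by a slide: a 1 at an end next to a
  2 merges with it into a 3.\<close>

lemma cat_csum_twos_1: "cat_csum (twos (Suc k) @ [1]) = cat_csum (twos k @ [3])"
  using cat_csum_snoc_1[of 2 "twos k"] by (simp add: replicate_app_Cons_same numeral_3_eq_3)

lemma cat_csum_1_twos: "cat_csum (1 # twos (Suc k) @ \<beta>) = cat_csum (3 # twos k @ \<beta>)"
  using cat_csum_Cons_1[of 2 "twos k @ \<beta>"] by (simp add: numeral_3_eq_3)

lemma cat_csum_twos_3: "cat_csum (twos k @ [3]) = cat_csum (3 # twos k)"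
  using cat_csum_rev[of "3 # twos k"] by simp

text \<open>The 1 passes \<open>m - 1\<close> entries 2, which gives \<open>m - 1\<close> products
  of each sign. The first positive product has the factor \<open>cat_csum [3]\<close>. In the last
  negative one the 1 stands next to the 3 and merges into a 4. The other positive products are
  paired with the negative ones of the preceding exchange, whence the range up to
  \<open>m - 2\<close>.\<close>

lemma cat_csum_shift_1_to_3:
  assumes "2 \<le> m"
  shows "cat_csum ([2, 1] @ twos (m - 1) @ 3 # twos m) =
    cat_csum (twos m @ [1, 3] @ twos m) - cat_csum (twos m) * cat_csum ([4] @ twos m) + cat_csum [3] * cat_csum (twos (m - 1) @ [3] @ twos m)
    + (\<Sum>i = 1..m - 2. cat_csum (twos i @ [3]) * cat_csum (twos (m - 1 - i) @ [3] @ twos m)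
        - cat_csum (twos (i + 1)) * cat_csum ([3] @ twos (m - 2 - i) @ [3] @ twos m))"
proof -
  obtain r where m: "m = Suc (Suc r)" using assms by (metis add_2_eq_Suc le_Suc_ex)
  let ?\<beta> = "3 # twos m"
  have first: "cat_csum (2 # twos i @ [1]) = cat_csum (twos i @ [3])" for i
    using cat_csum_twos_1[of i] by simp
  have last: "cat_csum (1 # ?\<beta>) = cat_csum (4 # twos m)"
    using cat_csum_Cons_1[of 3 "twos m"] by simp
  have "cat_csum ([2, 1] @ twos (Suc r) @ ?\<beta>) = cat_csum (twos m @ 1 # ?\<beta>) +
     (\<Sum>i<Suc r. cat_csum (twos i @ [3]) * cat_csum (twos (Suc r - i) @ ?\<beta>))
      - (\<Sum>i<Suc r. cat_csum (twos (Suc (Suc i))) * cat_csum (1 # twos (r - i) @ ?\<beta>))"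
    using slide_1[of "[2]" "Suc r" ?\<beta>] first by (simp add: m sum_subtractf)
  also have "(\<Sum>i<Suc r. cat_csum (twos i @ [3]) * cat_csum (twos (Suc r - i) @ ?\<beta>)) =
     cat_csum [3] * cat_csum (twos (Suc r) @ ?\<beta>) + (\<Sum>i<r. cat_csum (twos (Suc i) @ [3]) * cat_csum (twos (r - i) @ ?\<beta>))"
    by (subst sum.lessThan_Suc_shift) simp
  also have "(\<Sum>i<Suc r. cat_csum (twos (Suc (Suc i))) * cat_csum (1 # twos (r - i) @ ?\<beta>)) =
     (\<Sum>i<r. cat_csum (twos (Suc (Suc i))) * cat_csum (3 # twos (r - Suc i) @ ?\<beta>)) + cat_csum (twos m) * cat_csum (4 # twos m)"
  proof -
    have "cat_csum (1 # twos (r - i) @ ?\<beta>) = cat_csum (3 # twos (r - Suc i) @ ?\<beta>)" if "i < r" for i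
      using cat_csum_1_twos[of "r - Suc i" ?\<beta>] that by (simp only: Suc_diff_Suc)
    then show ?thesis using last by (simp add: m)
  qed
  finally show ?thesis
    by (simp add: m sum.atLeast1_atMost_eq sum_subtractf algebra_simps)
qed

text \<open>
  Sliding the 3 on the left and the 1 in the first term on the right to the far end yields two
  mutually reversed caterpillars. After sliding the 1 in the other terms as well, the remaining
  products telescope.
\<close>

lemma cat_csum_double_slide:
  assumes "2 \<le> m"
  shows "cat_csum ([2, 1] @ twos (m - 1) @ 3 # twos m) =
    cat_csum ([3] @ twos m @ [1] @ twos m) + cat_csum [2] * cat_csum ([3] @ twos (m - 1) @ [1] @ twos m)
    - cat_csum ([3] @ twos (m - 1)) * cat_csum ([2, 1] @ twos m)
    - cat_csum [1] * cat_csum (twos (m + 1) @ [1] @ twos m) + cat_csum [1] * cat_csum ([2, 1] @ twos (2 * m))"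
proof -
  \<comment> \<open>By the end rules every piece becomes a single vertex or a run of 2s with a 3 at
    no end, at one or at both; apart from \<open>X\<close> below, the claim is a polynomial identity
    in these quantities.\<close>
  define a b d o' where "a = (\<lambda>k. cat_csum (twos k))" and "b = (\<lambda>k. cat_csum (3 # twos k))"
    and "d = (\<lambda>k. cat_csum (3 # twos k @ [3]))" and "o' = cat_csum [1]"
  obtain r where m: "m = Suc (Suc r)" using assms by (metis add_2_eq_Suc le_Suc_ex)
  let ?n = "Suc r"
  have b': "cat_csum (twos k @ [3]) = b k" for k by (simp add: cat_csum_twos_3 b_def)
  have b1: "cat_csum (1 # twos (Suc k)) = b k" for k using cat_csum_1_twos[of k "[]"] by (simp add: b_def)
  have b2: "cat_csum (twos (Suc k) @ [1]) = b k" for k by (simp only: cat_csum_twos_1 b')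
  have d1: "cat_csum (3 # twos (Suc k) @ [1]) = d k" for k
    using cat_csum_snoc_1[of 2 "3 # twos k"] by (simp add: d_def replicate_app_Cons_same numeral_3_eq_3)
  \<comment> \<open>Sliding the 3 cuts off pieces that begin with 2, 1, which no end rule covers.
    One exchange at the front turns the 1 into an end.\<close>
  have start: "cat_csum (2 # 1 # \<gamma>) = cat_csum (1 # 2 # \<gamma>) + a 1 * cat_csum (1 # \<gamma>) - o' * cat_csum (2 # \<gamma>)" for \<gamma>
    using cat_csum_leaf_move[of 1 1 "[]" \<gamma>] by (simp add: numeral_2_eq_2 a_def o'_def)
  have l1: "cat_csum (2 # 1 # twos (Suc k) @ [3]) = d (Suc k) + a 1 * d k - o' * b (k + 2)" for k
    using start[of "twos (Suc k) @ [3]"] cat_csum_1_twos[of "Suc k" "[3]"] cat_csum_1_twos[of k "[3]"] b'[of "k + 2"]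
    by (simp add: d_def)
  have l2: "cat_csum (2 # 1 # twos (Suc k)) = b (Suc k) + a 1 * b k - o' * a (k + 2)" for k
    using start[of "twos (Suc k)"] b1[of "Suc k"] b1[of k] by (simp add: a_def)
  have twos_plus: "twos i @ twos j @ l = twos (i + j) @ l" for i j and l :: "nat list"
    by (simp add: replicate_add)
  \<comment> \<open>The common end of both slides. The left one reaches 2, 1, ..., 3, whose reversal
    ends in 1, 2; this is why the slide of the 1 in \<open>E\<close> stops before the last
    2.\<close>
  define X where "X = cat_csum (3 # twos (m + ?n) @ [1, 2])"

  have L: "cat_csum ([2, 1] @ twos (m - 1) @ 3 # twos m) = X +
    (\<Sum>i<m. cat_csum (2 # 1 # twos (?n + i) @ [3]) * a (m - i) - cat_csum (2 # 1 # twos (m + i)) * b (?n - i))"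
  proof -
    have "cat_csum (2 # 1 # twos k @ [3]) = cat_csum (3 # twos k @ [1, 2])" for k
      using cat_csum_rev[of "3 # twos k @ [1, 2]"] by simp
    then have "cat_csum (2 # 1 # twos (?n + m) @ [3]) = X"
      by (simp only: X_def add.commute)
    moreover have "twos ?n @ twos (Suc i) = twos (m + i)" for i
      by (simp only: replicate_add[symmetric]) (simp add: m)
    moreover have "m - Suc i = ?n - i" "m - 1 = ?n" for i
      by (simp_all add: m)
    ultimately show ?thesis
      using slide_3[of "2 # 1 # twos ?n" m "[]"]
      by (simp only: append_Cons append_Nil append_Nil2 append_assoc twos_plus a_def b_def)
  qed
  have E: "cat_csum ([3] @ twos m @ [1] @ twos m) = X +
    (\<Sum>i<?n. d (?n + i) * a (m - i) - b (m + Suc i) * b (r - i))"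
  proof -
    have 1: "twos m = twos ?n @ [2]" unfolding m by (simp add: replicate_append_same)
    have 2: "cat_csum (1 # twos (?n - Suc i) @ [2]) = b (r - i)" for i
      using b1[of "r - i"] by (simp add: replicate_append_same)
    have 3: "cat_csum (3 # twos m @ twos i @ [1]) = d (?n + i)" for i
      using d1[of "?n + i"] by (simp add: m twos_plus)
    have 4: "cat_csum (twos (?n - i) @ [2]) = a (m - i)" if "i < ?n" for i
      using that by (simp add: m a_def replicate_append_same Suc_diff_le)
    have 5: "cat_csum (3 # twos m @ twos (Suc i)) = b (m + Suc i)" for i
      by (simp only: b_def replicate_add)
    have "cat_csum ((3 # twos m) @ 1 # twos ?n @ [2]) = X +
      (\<Sum>i<?n. cat_csum (3 # twos m @ twos i @ [1]) * cat_csum (twos (?n - i) @ [2]) -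
        cat_csum (3 # twos m @ twos (Suc i)) * cat_csum (1 # twos (?n - Suc i) @ [2]))"
      using slide_1[of "3 # twos m" ?n "[2]"] by (simp only: X_def append_Cons twos_plus)
    also have "(\<Sum>i<?n. cat_csum (3 # twos m @ twos i @ [1]) * cat_csum (twos (?n - i) @ [2]) -
        cat_csum (3 # twos m @ twos (Suc i)) * cat_csum (1 # twos (?n - Suc i) @ [2])) =
      (\<Sum>i<?n. d (?n + i) * a (m - i) - b (m + Suc i) * b (r - i))"
      by (rule sum.cong[OF refl]) (simp only: 2 3 4 5 lessThan_iff)
    finally show ?thesis using 1 by simp
  qed
  \<comment> \<open>The 1 now runs to the very end. In the last product it is cut off alone, which
    yields \<open>o'\<close> instead of a value of \<open>b\<close> and hence the separate last
    term.\<close>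
  have F: "cat_csum ([3] @ twos (m - 1) @ [1] @ twos m) = d (2 * ?n) +
    (\<Sum>i<m. d (r + i) * a (m - i)) - (\<Sum>i<?n. b (m + i) * b (r - i)) - b (m + ?n) * o'"
  proof -
    have 2: "cat_csum (1 # twos (m - Suc i)) = b (r - i)" if "i < ?n" for i
      using b1[of "r - i"] that by (simp add: m Suc_diff_le)
    have 3: "cat_csum (3 # twos ?n @ twos i @ [1]) = d (r + i)" for i
      using d1[of "r + i"] by (simp add: twos_plus)
    have 5: "cat_csum (3 # twos ?n @ twos (Suc i)) = b (m + i)" for i
      by (simp add: b_def replicate_add m replicate_app_Cons_same)
    have 6: "r + m = 2 * ?n" by (simp add: m)
    have "cat_csum ((3 # twos ?n) @ 1 # twos m) = d (2 * ?n) +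
      (\<Sum>i<m. d (r + i) * a (m - i) - b (m + i) * cat_csum (1 # twos (m - Suc i)))"
      using slide_1[of "3 # twos ?n" m "[]"] by (simp only: append_Cons append_Nil2 3 5 6 a_def)
    then have "cat_csum ((3 # twos ?n) @ 1 # twos m) = d (2 * ?n) + (\<Sum>i<m. d (r + i) * a (m - i))
      - (\<Sum>i<m. b (m + i) * cat_csum (1 # twos (m - Suc i)))"
      by (simp only: sum_subtractf add_diff_eq)
    also have "(\<Sum>i<m. b (m + i) * cat_csum (1 # twos (m - Suc i))) =
      (\<Sum>i<?n. b (m + i) * b (r - i)) + b (m + ?n) * o'"
      using 2 by (simp add: m o'_def)
    finally show ?thesis by (simp add: sum_subtractf m)
  qed
  \<comment> \<open>The two products with \<open>cat_csum [1]\<close> in the claim differ by a slide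
    of the 1 through half of the run, so only the products of that slide survive.\<close>
  have O: "cat_csum ([2, 1] @ twos (2 * m)) = cat_csum (twos (m + 1) @ [1] @ twos m) +
    (\<Sum>i<m. b i * a (2 * m - i) - a (i + 2) * b (2 * ?n - i))"
  proof -
    have 2: "cat_csum (1 # twos (m - Suc i) @ twos m) = b (2 * ?n - i)" if "i < m" for i
    proof -
      have "m - Suc i + m = Suc (2 * ?n - i)" using that m by arith
      then show ?thesis by (simp only: replicate_add[symmetric] b1)
    qed
    have 3: "cat_csum (2 # twos i @ [1]) = b i" for i
      using b2[of i] by simp
    have 4: "cat_csum (twos (m - i) @ twos m) = a (2 * m - i)" if "i < m" for i
      using that by (simp add: a_def replicate_add[symmetric] mult_2)
    have "cat_csum ([2] @ 1 # twos m @ twos m) = cat_csum ([2] @ twos m @ 1 # twos m) +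
      (\<Sum>i<m. cat_csum (2 # twos i @ [1]) * cat_csum (twos (m - i) @ twos m)
        - cat_csum (2 # twos (Suc i)) * cat_csum (1 # twos (m - Suc i) @ twos m))"
      using slide_1[of "[2]" m "twos m"] by simp
    also have "(\<Sum>i<m. cat_csum (2 # twos i @ [1]) * cat_csum (twos (m - i) @ twos m)
        - cat_csum (2 # twos (Suc i)) * cat_csum (1 # twos (m - Suc i) @ twos m)) =
      (\<Sum>i<m. b i * a (2 * m - i) - a (i + 2) * b (2 * ?n - i))"
      by (rule sum.cong[OF refl]) (simp only: 2 3 4 lessThan_iff, simp add: a_def)
    finally show ?thesis by (simp add: mult_2 replicate_add)
  qed

  \<comment> \<open>The terms split off here are those left over on the right:
    \<open>d (2 * ?n)\<close> belongs to \<open>F\<close> multiplied by \<open>a 1\<close>, and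
    \<open>b m\<close> and \<open>b ?n\<close> belong to \<open>R1\<close> multiplied by
    \<open>b ?n\<close>.\<close>
  have s1: "(\<Sum>i<m. d (?n + i) * a (m - i)) =
      (\<Sum>i<?n. d (?n + i) * a (m - i)) + d (2 * ?n) * a 1"
    by (simp add: m mult_2)
  have s2: "(\<Sum>i<m. b (m + i) * b (?n - i)) = b m * b ?n + (\<Sum>i<?n. b (m + Suc i) * b (r - i))"
    unfolding m by (subst sum.lessThan_Suc_shift) simp
  have s3: "(\<Sum>i<m. b (?n + i) * b (?n - i)) = b ?n * b ?n + (\<Sum>i<?n. b (m + i) * b (r - i))"
    unfolding m by (subst sum.lessThan_Suc_shift) simp
  have s4: "(\<Sum>i<m. a (m + 1 + i) * b (?n - i) - b (m + i) * a (m - i)) =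
     b ?n * a (m + 1) - a 1 * b (m + ?n) + (\<Sum>i<m. b i * a (2 * m - i) - a (i + 2) * b (2 * ?n - i))"
  proof -
    have "(\<Sum>i<m. a (m + 1 + i) * b (?n - i) - b (m + i) * a (m - i)) =
      (\<Sum>i<m. a (m + 1 + (m - Suc i)) * b (?n - (m - Suc i)) - b (m + (m - Suc i)) * a (m - (m - Suc i)))"
      by (rule sum.nat_diff_reindex[symmetric])
    also have "\<dots> = (\<Sum>i<m. a (2 * m - i) * b i - b (m + ?n - i) * a (i + 1))"
    proof (rule sum.cong[OF refl])
      fix i assume "i \<in> {..<m}"
      then have "m + 1 + (m - Suc i) = 2 * m - i" "?n - (m - Suc i) = i"
        "m + (m - Suc i) = m + ?n - i" "m - (m - Suc i) = i + 1"
        using m by auto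
      then show "a (m + 1 + (m - Suc i)) * b (?n - (m - Suc i)) - b (m + (m - Suc i)) * a (m - (m - Suc i)) =
        a (2 * m - i) * b i - b (m + ?n - i) * a (i + 1)" by simp
    qed
    finally have 1: "(\<Sum>i<m. a (m + 1 + i) * b (?n - i) - b (m + i) * a (m - i)) =
      (\<Sum>i<m. a (2 * m - i) * b i - b (m + ?n - i) * a (i + 1))" .
    \<comment> \<open>The products \<open>b i * a (2 * m - i)\<close> occur on both sides. The
      others differ by a shift of the index, since \<open>m + ?n - Suc i = 2 * ?n - i\<close>, and
      telescope to the two boundary terms, which match the \<open>o'\<close> terms of
      \<open>R1\<close> and \<open>F\<close>.\<close>
    define t where "t i = a (i + 1) * b (m + ?n - i)" for i
    have "(\<Sum>i<m. a (i + 2) * b (2 * ?n - i) - a (i + 1) * b (m + ?n - i)) = (\<Sum>i<m. t (Suc i) - t i)"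
      by (rule sum.cong[OF refl]) (auto simp: m t_def mult_2)
    also have "\<dots> = t m - t 0" by (rule sum_lessThan_telescope)
    also have "\<dots> = b ?n * a (m + 1) - a 1 * b (m + ?n)" by (simp add: t_def)
    finally have "(\<Sum>i<m. a (i + 2) * b (2 * ?n - i) - a (i + 1) * b (m + ?n - i)) =
      b ?n * a (m + 1) - a 1 * b (m + ?n)" .
    then show ?thesis unfolding 1 by (simp add: sum_subtractf algebra_simps)
  qed
  have "(\<Sum>i<m. cat_csum (2 # 1 # twos (?n + i) @ [3]) * a (m - i) - cat_csum (2 # 1 # twos (m + i)) * b (?n - i)) =
    (\<Sum>i<m. (d (?n + i) + a 1 * d (r + i) - o' * b (m + i)) * a (m - i)
           - (b (m + i) + a 1 * b (?n + i) - o' * a (m + 1 + i)) * b (?n - i))"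
    using l1[of "r + _"] l2[of "?n + _"] by (simp add: m)
  also have "\<dots> = (\<Sum>i<m. d (?n + i) * a (m - i)) + a 1 * (\<Sum>i<m. d (r + i) * a (m - i))
     - (\<Sum>i<m. b (m + i) * b (?n - i)) - a 1 * (\<Sum>i<m. b (?n + i) * b (?n - i))
     + o' * (\<Sum>i<m. a (m + 1 + i) * b (?n - i) - b (m + i) * a (m - i))"
    unfolding sum_distrib_left sum.distrib[symmetric] sum_subtractf[symmetric]
    by (rule sum.cong[OF refl]) (simp add: algebra_simps)
  finally have S: "(\<Sum>i<m. cat_csum (2 # 1 # twos (?n + i) @ [3]) * a (m - i) - cat_csum (2 # 1 # twos (m + i)) * b (?n - i)) = \<dots>" .
  have R1: "cat_csum ([2, 1] @ twos m) = b m + a 1 * b ?n - o' * a (m + 1)"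
    using l2[of ?n] by (simp add: m)
  have R2: "cat_csum ([3] @ twos (m - 1)) = b ?n" "cat_csum [2] = a 1" "cat_csum [1] = o'"
    by (simp_all add: m b_def a_def o'_def)
  show ?thesis
    unfolding L E F O S s1 s2 s3 s4 R1 R2
    by (simp add: sum_subtractf algebra_simps)
qed

end

section \<open>Sums over proper colorings\<close>

definition proper :: "'a set set \<Rightarrow> ('a \<Rightarrow> nat) \<Rightarrow> bool" where
  "proper E \<kappa> \<longleftrightarrow> (\<forall>u v. {u, v} \<in> E \<longrightarrow> \<kappa> u \<noteq> \<kappa> v)"

lemma proper_insert: "proper (insert {u, v} E) \<kappa> \<longleftrightarrow> \<kappa> u \<noteq> \<kappa> v \<and> proper E \<kappa>"
  by (auto simp: proper_def doubleton_eq_iff)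

lemma proper_Un: "proper (E \<union> F) \<kappa> \<longleftrightarrow> proper E \<kappa> \<and> proper F \<kappa>"
  by (auto simp: proper_def)

lemma proper_cong:
  assumes "\<Union>E \<subseteq> V" "\<And>v. v \<in> V \<Longrightarrow> \<kappa> v = \<kappa>' v"
  shows "proper E \<kappa> = proper E \<kappa>'"
proof -
  have "u \<in> V \<and> v \<in> V" if "{u, v} \<in> E" for u v
    using that assms(1) by blast
  then show ?thesis unfolding proper_def using assms(2) by metis
qed

lemma proper_image:
  assumes "\<Union>E \<subseteq> V" "inj_on f V"
  shows "proper ((`) f ` E) \<kappa> = proper E (\<kappa> \<circ> f)"
proof
  assume *: "proper ((`) f ` E) \<kappa>"
  show "proper E (\<kappa> \<circ> f)"
    unfolding proper_def comp_def
  proof (intro allI impI)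
    fix u v assume "{u, v} \<in> E"
    then have "{f u, f v} \<in> (`) f ` E" using imageI[of "{u, v}" E "(`) f"] by simp
    then show "\<kappa> (f u) \<noteq> \<kappa> (f v)" by (rule *[unfolded proper_def, rule_format])
  qed
next
  assume *: "proper E (\<kappa> \<circ> f)"
  show "proper ((`) f ` E) \<kappa>"
    unfolding proper_def
  proof (intro allI impI)
    fix u v assume "{u, v} \<in> (`) f ` E"
    then obtain e where e: "e \<in> E" "f ` e = {u, v}" by auto
    then obtain a b where ab: "a \<in> e" "f a = u" "b \<in> e" "f b = v" by (metis imageE insertCI)
    \<comment> \<open>\<open>E\<close> is an arbitrary family of sets; that \<open>e\<close> has no
      elements besides \<open>a\<close> and \<open>b\<close> is recovered from its image by
      injectivity.\<close>
    have "c \<in> {a, b}" if "c \<in> e" for c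
    proof -
      have "f c \<in> {f a, f b}" using that e ab by blast
      moreover have "{a, b, c} \<subseteq> V" using that e(1) ab assms(1) by blast
      ultimately show ?thesis using assms(2) by (auto dest: inj_onD)
    qed
    then have "e = {a, b}" using ab by auto
    then show "\<kappa> u \<noteq> \<kappa> v" using * e(1) ab by (auto simp: proper_def)
  qed
qed

section \<open>Edges along a list of vertices\<close>

fun path_edges :: "'a list \<Rightarrow> 'a set set" where
  "path_edges (u # v # s) = insert {u, v} (path_edges (v # s))"
| "path_edges _ = {}"

lemma Union_path_edges: "\<Union>(path_edges s) \<subseteq> set s"
  by (induction s rule: path_edges.induct) auto

lemma path_edges_append:
  "s \<noteq> [] \<Longrightarrow> t \<noteq> [] \<Longrightarrow> path_edges (s @ t) = insert {last s, hd t} (path_edges s \<union> path_edges t)"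
proof (induction s rule: path_edges.induct)
  case ("2_2" v)
  then show ?case by (cases t) auto
qed (auto simp: insert_commute)

lemma path_edges_rev: "path_edges (rev s) = path_edges s"
proof (induction s rule: path_edges.induct)
  case (1 u v s)
  then show ?case using path_edges_append[of "rev (v # s)" "[u]"] by (simp add: insert_commute)
qed simp_all

lemma path_edges_map: "path_edges (map f s) = (`) f ` path_edges s"
  by (induction s rule: path_edges.induct) auto

lemma path_edges_upt: "path_edges [i..<j] = {{k, Suc k} |k. i \<le> k \<and> Suc k < j}"
proof (induction "j - i" arbitrary: i)
  case 0
  then show ?case by auto
next
  case (Suc d)
  show ?case
  proof (cases "Suc i < j")
    case True
    then have "[i..<j] = i # Suc i # [Suc (Suc i)..<j]" by (simp add: upt_conv_Cons)
    then have "path_edges [i..<j] = insert {i, Suc i} (path_edges [Suc i..<j])"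
      using True by (simp add: upt_conv_Cons)
    also have "\<dots> = {{k, Suc k} |k. i \<le> k \<and> Suc k < j}"
      using Suc(1)[of "Suc i"] Suc(2) True by (auto simp: Suc_le_eq)
    finally show ?thesis .
  next
    case False
    then have "[i..<j] = [i]" using Suc(2) by (simp add: upt_rec)
    then show ?thesis using False by auto
  qed
qed

lemma path_edges_map_upt: "path_edges (map f [i..<j]) = (\<lambda>k. {f k, f (Suc k)}) ` {k. i \<le> k \<and> Suc k < j}"
  by (simp add: path_edges_map path_edges_upt setcompr_eq_image image_image)

context color_weights
begin

text \<open>The chromatic symmetric function restricted to the variables indexed by \<open>C\<close>
  and evaluated at \<open>x\<close>. Vertex and edge sets are separate arguments because the moves
  change edges over a fixed vertex set.\<close>

definition csum :: "'a set \<Rightarrow> 'a set set \<Rightarrow> 'r" where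
  "csum V E = (\<Sum>\<kappa>\<in>V \<rightarrow>\<^sub>E C. if proper E \<kappa> then \<Prod>v\<in>V. x (\<kappa> v) else 0)"

definition rsum :: "'a set \<Rightarrow> 'a set set \<Rightarrow> 'a \<Rightarrow> nat \<Rightarrow> 'r" where
  "rsum V E u k = (\<Sum>\<kappa>\<in>V \<rightarrow>\<^sub>E C. if proper E \<kappa> \<and> \<kappa> u = k then \<Prod>v\<in>V. x (\<kappa> v) else 0)"

lemma sum_R:
  assumes "u \<in> V"
  shows "(\<Sum>k\<in>C. rsum V E u k) = csum V E"
proof -
  have "(\<Sum>k\<in>C. if proper E \<kappa> \<and> \<kappa> u = k then \<Prod>v\<in>V. x (\<kappa> v) else 0) =
      (if proper E \<kappa> then \<Prod>v\<in>V. x (\<kappa> v) else 0)" if "\<kappa> \<in> V \<rightarrow>\<^sub>E C" for \<kappa>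
  proof -
    have "\<kappa> u \<in> C" using that assms by auto
    then show ?thesis by (auto simp: sum.delta'[OF finite_C])
  qed
  then show ?thesis
    unfolding rsum_def csum_def by (subst sum.swap) (rule sum.cong[OF refl])
qed

lemma sum_PiE_insert:
  assumes "v \<notin> V"
  shows "(\<Sum>\<kappa>\<in>insert v V \<rightarrow>\<^sub>E C. F \<kappa>) = (\<Sum>\<kappa>\<in>V \<rightarrow>\<^sub>E C. \<Sum>l\<in>C. F (\<kappa>(v := l)))"
proof -
  have "(\<Sum>\<kappa>\<in>insert v V \<rightarrow>\<^sub>E C. F \<kappa>) = (\<Sum>(l, \<kappa>)\<in>C \<times> (V \<rightarrow>\<^sub>E C). F (\<kappa>(v := l)))"
    unfolding PiE_insert_eq by (subst sum.reindex[OF inj_combinator[OF assms]]) (auto intro: sum.cong)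
  also have "\<dots> = (\<Sum>l\<in>C. \<Sum>\<kappa>\<in>V \<rightarrow>\<^sub>E C. F (\<kappa>(v := l)))"
    by (rule sum.cartesian_product[symmetric])
  also have "\<dots> = (\<Sum>\<kappa>\<in>V \<rightarrow>\<^sub>E C. \<Sum>l\<in>C. F (\<kappa>(v := l)))" by (rule sum.swap)
  finally show ?thesis .
qed

lemma sum_if_neq: "finite A \<Longrightarrow> a \<in> A \<Longrightarrow> (\<Sum>l\<in>A. if a \<noteq> l then f l else 0) = sum f A - (f a :: 'r)"
  by (subst (2) sum.remove[of _ a]) (auto simp: sum.If_cases set_diff_eq intro!: sum.cong)

context
  fixes V :: "'a set" and E :: "'a set set" and u v :: 'a
  assumes fin: "finite V" and v: "v \<notin> V" and u: "u \<in> V" and E: "\<Union>E \<subseteq> V"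
begin

lemma proper_new: "proper (insert {u, v} E) (\<kappa>(v := l)) \<longleftrightarrow> \<kappa> u \<noteq> l \<and> proper E \<kappa>"
proof -
  have "proper E (\<kappa>(v := l)) = proper E \<kappa>" using v by (intro proper_cong[OF E]) auto
  then show ?thesis using u v by (auto simp: proper_insert)
qed

lemma prod_new: "(\<Prod>w\<in>insert v V. x ((\<kappa>(v := l)) w)) = x l * (\<Prod>w\<in>V. x (\<kappa> w))"
  using fin v by (auto intro!: arg_cong[of _ _ "(*) _"] prod.cong)

lemma rsum_new_leaf:
  "rsum (insert v V) (insert {u, v} E) u k = (total - x k) * rsum V E u k" if "k \<in> C"
proof -
  have "rsum (insert v V) (insert {u, v} E) u k =
    (\<Sum>\<kappa>\<in>V \<rightarrow>\<^sub>E C. \<Sum>l\<in>C. if proper E \<kappa> \<and> \<kappa> u = k then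
       (if k \<noteq> l then x l * (\<Prod>w\<in>V. x (\<kappa> w)) else 0) else 0)"
    unfolding rsum_def sum_PiE_insert[OF v] proper_new prod_new
    using u v by (intro sum.cong refl) auto
  also have "\<dots> = (\<Sum>\<kappa>\<in>V \<rightarrow>\<^sub>E C. if proper E \<kappa> \<and> \<kappa> u = k then (total - x k) * (\<Prod>w\<in>V. x (\<kappa> w)) else 0)"
    by (intro sum.cong refl)
      (auto simp: sum_if_neq[OF finite_C that] total_def sum_distrib_right left_diff_distrib)
  also have "\<dots> = (total - x k) * rsum V E u k"
    unfolding rsum_def sum_distrib_left by (intro sum.cong refl) simp
  finally show ?thesis .
qed

text \<open>If the attached vertex becomes the root, its color is forbidden at \<open>u\<close>.
  This is the difference in the recursion of \<open>cat_rsum\<close>, just as a new leaf gives the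
  factor \<open>total - x k\<close>.\<close>

lemma rsum_new_root:
  "rsum (insert v V) (insert {u, v} E) v k = x k * (csum V E - rsum V E u k)" if "k \<in> C"
proof -
  have "rsum (insert v V) (insert {u, v} E) v k =
    (\<Sum>\<kappa>\<in>V \<rightarrow>\<^sub>E C. \<Sum>l\<in>C. if k = l then
       (if proper E \<kappa> \<and> \<kappa> u \<noteq> k then x k * (\<Prod>w\<in>V. x (\<kappa> w)) else 0) else 0)"
    unfolding rsum_def sum_PiE_insert[OF v] proper_new prod_new
    using u v by (intro sum.cong refl) auto
  also have "\<dots> = (\<Sum>\<kappa>\<in>V \<rightarrow>\<^sub>E C. if proper E \<kappa> \<and> \<kappa> u \<noteq> k then x k * (\<Prod>w\<in>V. x (\<kappa> w)) else 0)"
    using that by (simp add: sum.delta[OF finite_C] sum.delta'[OF finite_C])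
  also have "\<dots> = x k * (csum V E - rsum V E u k)"
    unfolding rsum_def csum_def sum_subtractf[symmetric] sum_distrib_left by (intro sum.cong refl) auto
  finally show ?thesis .
qed

end

lemma rsum_new_leaves:
  assumes "finite M" "finite V" "M \<inter> V = {}" "u \<in> V" "\<Union>E \<subseteq> V" "k \<in> C"
  shows "rsum (V \<union> M) (E \<union> (\<lambda>v. {u, v}) ` M) u k = (total - x k) ^ card M * rsum V E u k"
  using assms(1,3)
proof (induction M rule: finite_induct)
  case empty
  then show ?case by simp
next
  case (insert v M)
  have "rsum (insert v (V \<union> M)) (insert {u, v} (E \<union> (\<lambda>v. {u, v}) ` M)) u k =
    (total - x k) * rsum (V \<union> M) (E \<union> (\<lambda>v. {u, v}) ` M) u k"
    by (rule rsum_new_leaf) (use insert assms in auto)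
  then show ?case using insert by (simp add: algebra_simps)
qed

text \<open>The spine is built from its far end: each vertex enters as a new root and then receives
  its leaves \<open>M1\<close>, while \<open>M2\<close> holds the leaves further on. Leaves are
  given by any set \<open>M\<close> with a map \<open>h\<close> to the spine, so that the result
  applies to caterpillars embedded with arbitrary labels.\<close>

lemma rsum_caterpillar:
  assumes "s \<noteq> []" "distinct s" "finite M" "M \<inter> set s = {}" "h ` M \<subseteq> set s" "k \<in> C"
  shows "rsum (set s \<union> M) (path_edges s \<union> (\<lambda>v. {h v, v}) ` M) (hd s) k =
    cat_rsum (map (\<lambda>u. Suc (card {v \<in> M. h v = u})) s) k"
  using assms
proof (induction s arbitrary: M k)
  case Nil
  then show ?case by simp
next
  case (Cons u s)
  define M1 M2 where "M1 = {v \<in> M. h v = u}" and "M2 = {v \<in> M. h v \<noteq> u}"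
  let ?E = "path_edges s \<union> (\<lambda>v. {h v, v}) ` M2"
  have M: "M = M2 \<union> M1" by (auto simp: M1_def M2_def)
  have E: "\<Union>?E \<subseteq> set s \<union> M2"
    using Union_path_edges[of s] Cons.prems(5) by (auto simp: M2_def)
  have cong: "map (\<lambda>u. Suc (card {v \<in> M2. h v = u})) s = map (\<lambda>u. Suc (card {v \<in> M. h v = u})) s"
    using Cons.prems(2) by (auto simp: M2_def intro!: arg_cong[of _ _ card])
  let ?V = "insert u (set s \<union> M2)" and ?E' = "path_edges (u # s) \<union> (\<lambda>v. {h v, v}) ` M2"
  have root: "rsum ?V ?E' u k =
    x k * (if s = [] then 1 else cat_csum (map (\<lambda>u. Suc (card {v \<in> M. h v = u})) s) - cat_rsum (map (\<lambda>u. Suc (card {v \<in> M. h v = u})) s) k)"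
  proof (cases s)
    case Nil
    then have "M2 = {}" using Cons.prems(5) by (auto simp: M2_def)
    have "rsum {u} {} u k = (\<Sum>l\<in>C. if l = k then x l else 0)"
      unfolding rsum_def by (simp add: sum_PiE_insert proper_def cong: if_cong)
    also have "\<dots> = x k" using Cons.prems(6) finite_C by simp
    finally show ?thesis using Nil \<open>M2 = {}\<close> by simp
  next
    case s: (Cons w t)
    have IH: "rsum (set s \<union> M2) ?E w l = cat_rsum (map (\<lambda>u. Suc (card {v \<in> M. h v = u})) s) l" if "l \<in> C" for l
    proof -
      have "rsum (set s \<union> M2) ?E (hd s) l = cat_rsum (map (\<lambda>u. Suc (card {v \<in> M2. h v = u})) s) l"
        by (rule Cons.IH) (use Cons.prems that s in \<open>auto simp: M2_def\<close>)
      then show ?thesis unfolding cong by (simp add: s)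
    qed
    have "csum (set s \<union> M2) ?E = cat_csum (map (\<lambda>u. Suc (card {v \<in> M. h v = u})) s)"
      using sum_R[of w "set s \<union> M2" ?E] s IH by (simp add: cat_csum_def)
    moreover have "rsum ?V (insert {w, u} ?E) u k = x k * (csum (set s \<union> M2) ?E - rsum (set s \<union> M2) ?E w k)"
      by (rule rsum_new_root) (use Cons.prems s E in \<open>auto simp: M2_def\<close>)
    moreover have "insert {w, u} ?E = ?E'" by (simp add: s insert_commute)
    ultimately show ?thesis using IH[OF Cons.prems(6)] s by simp
  qed
  have "rsum (?V \<union> M1) (?E' \<union> (\<lambda>v. {u, v}) ` M1) u k = (total - x k) ^ card M1 * rsum ?V ?E' u k"
  proof (rule rsum_new_leaves)
    show "\<Union>?E' \<subseteq> ?V"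
      using E Union_path_edges[of "u # s"] by auto
  qed (use Cons.prems in \<open>auto simp: M1_def M2_def\<close>)
  moreover have "?E' \<union> (\<lambda>v. {u, v}) ` M1 = path_edges (u # s) \<union> (\<lambda>v. {h v, v}) ` M"
    by (auto simp: M1_def M2_def)
  moreover have "?V \<union> M1 = set (u # s) \<union> M" using M by auto
  ultimately show ?case
    by (simp add: root M1_def cat_rsum.simps cat_csum_def)
qed

lemma csum_caterpillar:
  assumes "s \<noteq> []" "distinct s" "finite M" "M \<inter> set s = {}" "h ` M \<subseteq> set s"
  shows "csum (set s \<union> M) (path_edges s \<union> (\<lambda>v. {h v, v}) ` M) =
    cat_csum (map (\<lambda>u. Suc (card {v \<in> M. h v = u})) s)"
proof -
  have "hd s \<in> set s \<union> M" using assms(1) by simp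
  then show ?thesis
    unfolding cat_csum_def sum_R[symmetric, OF \<open>hd s \<in> set s \<union> M\<close>] by (intro sum.cong refl rsum_caterpillar assms)
qed

lemma csum_image:
  assumes "inj_on f V" "\<Union>E \<subseteq> V"
  shows "csum (f ` V) ((`) f ` E) = csum V E"
  unfolding csum_def
proof (rule sum.reindex_bij_witness[where
      i = "\<lambda>\<kappa>. restrict (\<kappa> \<circ> inv_into V f) (f ` V)" and j = "\<lambda>\<kappa>. restrict (\<kappa> \<circ> f) V"])
  fix \<kappa> assume \<kappa>: "\<kappa> \<in> f ` V \<rightarrow>\<^sub>E C"
  have "restrict (restrict (\<kappa> \<circ> f) V \<circ> inv_into V f) (f ` V) w = \<kappa> w" for w
  proof (cases "w \<in> f ` V")
    case True
    then show ?thesis by (simp add: inv_into_into f_inv_into_f)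
  next
    case False
    then show ?thesis using \<kappa> by (auto simp: PiE_def extensional_def)
  qed
  then show "restrict (restrict (\<kappa> \<circ> f) V \<circ> inv_into V f) (f ` V) = \<kappa>" by blast
  show "restrict (\<kappa> \<circ> f) V \<in> V \<rightarrow>\<^sub>E C" using \<kappa> by auto
  have "proper E (restrict (\<kappa> \<circ> f) V) = proper E (\<kappa> \<circ> f)"
    by (rule proper_cong[OF assms(2)]) simp
  then show "(if proper E (restrict (\<kappa> \<circ> f) V) then \<Prod>v\<in>V. x (restrict (\<kappa> \<circ> f) V v) else 0) =
    (if proper ((`) f ` E) \<kappa> then \<Prod>v\<in>f ` V. x (\<kappa> v) else 0)"
    by (simp add: proper_image[OF assms(2,1)] prod.reindex[OF assms(1)])
next
  fix \<kappa> assume \<kappa>: "\<kappa> \<in> V \<rightarrow>\<^sub>E C"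
  then show "restrict (restrict (\<kappa> \<circ> inv_into V f) (f ` V) \<circ> f) V = \<kappa>"
    using assms(1) by (intro ext) (auto simp: PiE_def extensional_def)
  show "restrict (\<kappa> \<circ> inv_into V f) (f ` V) \<in> f ` V \<rightarrow>\<^sub>E C"
    using \<kappa> assms(1) by auto
qed

lemma csum_Un:
  assumes "finite V" "finite V'" "V \<inter> V' = {}" "\<Union>E \<subseteq> V" "\<Union>E' \<subseteq> V'"
  shows "csum (V \<union> V') (E \<union> E') = csum V E * csum V' E'"
proof -
  have "csum V E * csum V' E' = (\<Sum>(\<kappa>, \<kappa>')\<in>(V \<rightarrow>\<^sub>E C) \<times> (V' \<rightarrow>\<^sub>E C).
    (if proper E \<kappa> then \<Prod>v\<in>V. x (\<kappa> v) else 0) * (if proper E' \<kappa>' then \<Prod>v\<in>V'. x (\<kappa>' v) else 0))"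
    unfolding csum_def sum_product by (rule sum.cartesian_product)
  also have "\<dots> = csum (V \<union> V') (E \<union> E')"
    unfolding csum_def
  proof (rule sum.reindex_bij_witness[where
      i = "\<lambda>\<kappa>. (restrict \<kappa> V, restrict \<kappa> V')" and
      j = "\<lambda>z v. if v \<in> V then fst z v else snd z v"])
    fix z assume "z \<in> (V \<rightarrow>\<^sub>E C) \<times> (V' \<rightarrow>\<^sub>E C)"
    then obtain \<kappa> \<kappa>' where z: "z = (\<kappa>, \<kappa>')" and k: "\<kappa> \<in> V \<rightarrow>\<^sub>E C" "\<kappa>' \<in> V' \<rightarrow>\<^sub>E C" by auto
    let ?k = "\<lambda>v. if v \<in> V then fst z v else snd z v"
    have k': "?k v = \<kappa>' v" if "v \<in> V'" for v using assms(3) that z by auto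
    have "restrict ?k V = \<kappa>"
      using k by (intro ext) (auto simp: z PiE_def extensional_def)
    moreover have "restrict ?k V' = \<kappa>'"
      using k k' by (intro ext) (auto simp: restrict_def PiE_def extensional_def)
    ultimately show "(restrict ?k V, restrict ?k V') = z" by (simp only: z)
    show "?k \<in> V \<union> V' \<rightarrow>\<^sub>E C" using k by (auto simp: z PiE_def extensional_def)
    have "proper E ?k = proper E \<kappa>" "proper E' ?k = proper E' \<kappa>'"
      using k' by (auto simp: z intro!: proper_cong[OF assms(4)] proper_cong[OF assms(5)])
    moreover have "(\<Prod>v\<in>V \<union> V'. x (?k v)) = (\<Prod>v\<in>V. x (\<kappa> v)) * (\<Prod>v\<in>V'. x (\<kappa>' v))"
      unfolding prod.union_disjoint[OF assms(1-3)] using k' by (simp add: z)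
    ultimately show "(if proper (E \<union> E') ?k then \<Prod>v\<in>V \<union> V'. x (?k v) else 0) =
      (case z of (\<kappa>, \<kappa>') \<Rightarrow> (if proper E \<kappa> then \<Prod>v\<in>V. x (\<kappa> v) else 0) *
        (if proper E' \<kappa>' then \<Prod>v\<in>V'. x (\<kappa>' v) else 0))"
      by (simp add: proper_Un z)
  next
    fix \<kappa> assume "\<kappa> \<in> V \<union> V' \<rightarrow>\<^sub>E C"
    then show "(\<lambda>v. if v \<in> V then fst (restrict \<kappa> V, restrict \<kappa> V') v
        else snd (restrict \<kappa> V, restrict \<kappa> V') v) = \<kappa>"
      by (intro ext) (auto simp: PiE_def extensional_def)
    show "(restrict \<kappa> V, restrict \<kappa> V') \<in> (V \<rightarrow>\<^sub>E C) \<times> (V' \<rightarrow>\<^sub>E C)"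
      using \<open>\<kappa> \<in> V \<union> V' \<rightarrow>\<^sub>E C\<close> by auto
  qed
  finally show ?thesis by simp
qed

text \<open>Triple deletion of Orellana and Scott.\<close>

lemma csum_triangle:
  "csum V (E \<union> {{a, b}, {b, c}}) = csum V (E \<union> {{b, c}, {a, c}}) + csum V (E \<union> {{a, b}}) - csum V (E \<union> {{a, c}})"
  unfolding csum_def sum.distrib[symmetric] sum_subtractf[symmetric]
  by (rule sum.cong[OF refl]) (auto simp: proper_insert)

text \<open>Both hypotheses matter: the graph without vertices has sum 1 whereas
  \<open>cat_csum []\<close> is 0, and an entry 0 has no spine vertex in \<open>verts\<close>
  whereas \<open>cat_csum\<close> counts it like a 1.\<close>

lemma csum_cat:
  assumes "\<alpha> \<noteq> []" "\<forall>a\<in>set \<alpha>. 0 < a"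
  shows "csum (verts (caterpillar \<alpha>)) (edges (caterpillar \<alpha>)) = cat_csum \<alpha>"
proof -
  let ?s = "map (\<lambda>i. (i, 0 :: nat)) [1..<Suc (length \<alpha>)]"
  let ?M = "SIGMA i:{1..length \<alpha>}. {1..<\<alpha> ! (i - 1)}" and ?h = "\<lambda>(i :: nat, j :: nat). (i, 0 :: nat)"
  have pos: "0 < \<alpha> ! (i - 1)" if "i \<in> {1..length \<alpha>}" for i
    using assms(2) that by (auto intro!: nth_mem)
  have "path_edges ?s = {{(i, 0), (i + 1, 0)} |i. 1 \<le> i \<and> i < length \<alpha>}"
    by (auto simp: path_edges_map_upt simp del: upt_Suc)
  moreover have "(\<lambda>v. {?h v, v}) ` ?M =
      {{(i, 0), (i, j)} |i j. 1 \<le> i \<and> i \<le> length \<alpha> \<and> 1 \<le> j \<and> j < \<alpha> ! (i - 1)}"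
  proof (intro set_eqI iffI)
    fix e assume "e \<in> (\<lambda>v. {?h v, v}) ` ?M"
    then obtain i j where "(i, j) \<in> ?M" "e = {(i, 0), (i, j)}" by (elim imageE) auto
    then show "e \<in> {{(i, 0), (i, j)} |i j. 1 \<le> i \<and> i \<le> length \<alpha> \<and> 1 \<le> j \<and> j < \<alpha> ! (i - 1)}"
      by simp blast
  next
    fix e assume "e \<in> {{(i, 0), (i, j)} |i j. 1 \<le> i \<and> i \<le> length \<alpha> \<and> 1 \<le> j \<and> j < \<alpha> ! (i - 1)}"
    then obtain i j where ij: "1 \<le> i" "i \<le> length \<alpha>" "1 \<le> j" "j < \<alpha> ! (i - 1)" "e = {(i, 0), (i, j)}"
      by blast
    show "e \<in> (\<lambda>v. {?h v, v}) ` ?M"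
      by (rule image_eqI[of _ _ "(i, j)"]) (use ij in auto)
  qed
  moreover have "set ?s \<union> ?M = verts (caterpillar \<alpha>)"
    using pos by (auto simp: caterpillar_def Suc_le_eq neq0_conv[symmetric] simp del: neq0_conv)
  moreover have "csum (set ?s \<union> ?M) (path_edges ?s \<union> (\<lambda>v. {?h v, v}) ` ?M) =
      cat_csum (map (\<lambda>u. Suc (card {v \<in> ?M. ?h v = u})) ?s)"
    by (rule csum_caterpillar) (use assms in \<open>auto simp: distinct_map inj_on_def Suc_le_eq\<close>)
  moreover have "map (\<lambda>u. Suc (card {v \<in> ?M. ?h v = u})) ?s = \<alpha>"
  proof (rule nth_equalityI)
    fix i assume "i < length (map (\<lambda>u. Suc (card {v \<in> ?M. ?h v = u})) ?s)"
    then have i: "i < length \<alpha>" by (simp del: upt_Suc)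
    then have "{v \<in> ?M. ?h v = (Suc i, 0)} = Pair (Suc i) ` {1..<\<alpha> ! i}" by auto
    then have "card {v \<in> ?M. ?h v = (Suc i, 0)} = card (Pair (Suc i) ` {1..<\<alpha> ! i})" by (rule arg_cong)
    also have "\<dots> = \<alpha> ! i - 1" by (simp add: card_image inj_on_def)
    finally have "card {v \<in> ?M. ?h v = (Suc i, 0)} = \<alpha> ! i - 1" .
    then show "map (\<lambda>u. Suc (card {v \<in> ?M. ?h v = u})) ?s ! i = \<alpha> ! i"
      using i pos[of "Suc i"] by (simp del: upt_Suc)
  qed (simp del: upt_Suc)
  ultimately show ?thesis by (simp add: caterpillar_def)
qed

lemma csum_disj_union:
  fixes G :: "'a ugraph" and H :: "'b ugraph"
  assumes "fin_simple_graph G" "fin_simple_graph H"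
  shows "csum (verts (G \<squnion>\<^sub>g H)) (edges (G \<squnion>\<^sub>g H)) = csum (verts G) (edges G) * csum (verts H) (edges H)"
proof -
  have G: "\<Union>(edges G) \<subseteq> verts G" and H: "\<Union>(edges H) \<subseteq> verts H"
    using assms by (auto simp: fin_simple_graph_def)
  have "csum (Inl ` verts G \<union> Inr ` verts H) ((`) Inl ` edges G \<union> (`) Inr ` edges H) =
    csum (Inl ` verts G :: ('a + 'b) set) ((`) Inl ` edges G) * csum (Inr ` verts H :: ('a + 'b) set) ((`) Inr ` edges H)"
    by (rule csum_Un) (use assms G H in \<open>auto simp: fin_simple_graph_def\<close>)
  then show ?thesis
    using G H by (simp add: disj_union_def Plus_def csum_image)
qed

lemma csum_two_cats:
  assumes "\<alpha> \<noteq> []" "\<forall>a\<in>set \<alpha>. 0 < a" "\<beta> \<noteq> []" "\<forall>a\<in>set \<beta>. 0 < a"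
  shows "csum (verts (caterpillar \<alpha> \<squnion>\<^sub>g caterpillar \<beta>)) (edges (caterpillar \<alpha> \<squnion>\<^sub>g caterpillar \<beta>)) = cat_csum \<alpha> * cat_csum \<beta>"
  using assms by (simp add: csum_disj_union csum_cat fin_simple_graph_caterpillar Suc_le_eq)

end

text \<open>
  Coefficients at monomials in the variables with index below \<open>N\<close> only see colors below \<open>N\<close>,
  so they can be computed in a genuine ring of polynomials.
\<close>

definition color_var :: "nat \<Rightarrow> nat multiset \<Rightarrow>\<^sub>0 int" where
  "color_var i = Poly_Mapping.single {#i#} 1"

lemma prod_color_var:
  "finite V \<Longrightarrow> (\<Prod>v\<in>V. color_var (\<kappa> v)) = Poly_Mapping.single (image_mset \<kappa> (mset_set V)) 1"
  by (induction V rule: finite_induct) (auto simp: color_var_def mult_single)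

lemma csf_eq_lookup_W:
  assumes "finite (verts G)" "set_mset m \<subseteq> {..<N}"
  shows "csf G m = Poly_Mapping.lookup (color_weights.csum {..<N} color_var (verts G) (edges G)) m"
proof -
  interpret color_weights "{..<N}" color_var by unfold_locales simp
  let ?P = "\<lambda>\<kappa>. proper (edges G) \<kappa> \<and> coloring_monomial G \<kappa> = m"
  have "Poly_Mapping.lookup (color_weights.csum {..<N} color_var (verts G) (edges G)) m =
    (\<Sum>\<kappa>\<in>verts G \<rightarrow>\<^sub>E {..<N}. if ?P \<kappa> then 1 else 0)"
    unfolding csum_def lookup_sum
    by (rule sum.cong[OF refl])
      (auto simp: prod_color_var[OF assms(1)] lookup_single coloring_monomial_def when_def)
  also have "\<dots> = int (card {\<kappa> \<in> verts G \<rightarrow>\<^sub>E {..<N}. ?P \<kappa>})"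
    by (simp add: sum.If_cases finite_PiE assms(1) Int_def)
  also have "{\<kappa> \<in> verts G \<rightarrow>\<^sub>E {..<N}. ?P \<kappa>} = {\<kappa> \<in> proper_colorings G. coloring_monomial G \<kappa> = m}"
  proof -
    have "\<kappa> \<in> verts G \<rightarrow>\<^sub>E {..<N}" if "\<kappa> \<in> verts G \<rightarrow>\<^sub>E UNIV" "coloring_monomial G \<kappa> = m" for \<kappa>
    proof -
      have "\<kappa> ` verts G = set_mset m" using that(2) assms(1) by (auto simp: coloring_monomial_def)
      then show ?thesis using assms(2) that(1) by (auto simp: PiE_iff)
    qed
    then show ?thesis by (auto simp: proper_colorings_def proper_def)
  qed
  finally show ?thesis by (simp add: csf_def)
qed

section \<open>Forests on the vertices of the base graph\<close>

lemma vertex_eq_simps [simp]: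
  "vL i = vL j \<longleftrightarrow> i = j" "vR i = vR j \<longleftrightarrow> i = j" "fL i = fL j \<longleftrightarrow> i = j" "fR i = fR j \<longleftrightarrow> i = j"
  "vL i \<noteq> vR j" "vL i \<noteq> fL j" "vL i \<noteq> fR j" "vR i \<noteq> vL j" "vR i \<noteq> fL j" "vR i \<noteq> fR j"
  "fL i \<noteq> vL j" "fL i \<noteq> vR j" "fL i \<noteq> fR j" "fR i \<noteq> vL j" "fR i \<noteq> vR j" "fR i \<noteq> fL j"
  by (auto simp: vL_def vR_def fL_def fR_def)

text \<open>
  All graphs of the proof live on the vertex set of \<open>base_graph\<close>. Every leaf keeps its own spine
  vertex except \<open>fL 2\<close> and \<open>fR 1\<close>, which are attached to \<open>p\<close> and \<open>q\<close>.
\<close>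

definition leaf_edges :: "nat set \<Rightarrow> nat set \<Rightarrow> two_cat_vertex \<Rightarrow> two_cat_vertex \<Rightarrow> two_cat_vertex set set" where
  "leaf_edges I J p q =
     (\<lambda>i. {vL i, fL i}) ` (I - {2}) \<union> (if 2 \<in> I then {{p, fL 2}} else {}) \<union>
     (\<lambda>i. {vR i, fR i}) ` (J - {1}) \<union> (if 1 \<in> J then {{q, fR 1}} else {})"

text \<open>The map \<open>h\<close> from leaves to spine vertices; only its values at leaves
  matter.\<close>

fun support :: "two_cat_vertex \<Rightarrow> two_cat_vertex \<Rightarrow> two_cat_vertex \<Rightarrow> two_cat_vertex" where
  "support p q (Inl (i, j)) = (if i = 2 then p else vL i)"
| "support p q (Inr (i, j)) = (if i = 1 then q else vR i)"

lemma support_leaf [simp]: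
  "support p q (fL i) = (if i = 2 then p else vL i)"
  "support p q (fR i) = (if i = 1 then q else vR i)"
  by (simp_all add: fL_def fR_def)

lemma leaf_edges_eq:
  "(\<lambda>v. {support p q v, v}) ` (fL ` I \<union> fR ` J) = leaf_edges I J p q"
proof -
  have "(\<lambda>v. {support p q v, v}) ` fL ` I = (\<lambda>i. if i = 2 then {p, fL 2} else {vL i, fL i}) ` I"
    "(\<lambda>v. {support p q v, v}) ` fR ` J = (\<lambda>j. if j = 1 then {q, fR 1} else {vR j, fR j}) ` J"
    unfolding image_image by (rule image_cong[OF refl], simp)+
  moreover have "(\<lambda>i. if i = a then u else f i) ` A = f ` (A - {a}) \<union> (if a \<in> A then {u} else {})"
    for a :: nat and u :: "two_cat_vertex set" and f A
    by auto
  ultimately show ?thesis by (simp only: image_Un leaf_edges_def Un_assoc)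
qed

text \<open>The entry of the composition at the spine vertex \<open>u\<close>.\<close>

definition block_size :: "nat set \<Rightarrow> nat set \<Rightarrow> two_cat_vertex \<Rightarrow> two_cat_vertex \<Rightarrow> two_cat_vertex \<Rightarrow> nat" where
  "block_size I J p q u = Suc (card {v \<in> fL ` I \<union> fR ` J. support p q v = u})"

lemma block_size_vL:
  "block_size I J p q (vL k) = 1 + (if k \<in> I \<and> k \<noteq> 2 then 1 else 0)
     + (if 2 \<in> I \<and> p = vL k then 1 else 0) + (if 1 \<in> J \<and> q = vL k then 1 else 0)"
proof -
  have blocks: "{v \<in> fL ` I \<union> fR ` J. support p q v = vL k} =
    (if k \<in> I \<and> k \<noteq> 2 then {fL k} else {}) \<union> (if 2 \<in> I \<and> p = vL k then {fL 2} else {})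
    \<union> (if 1 \<in> J \<and> q = vL k then {fR 1} else {})"
    by (auto split: if_splits)
  show ?thesis unfolding block_size_def blocks by (auto simp: card_insert_if)
qed

lemma block_size_vR:
  "block_size I J p q (vR k) = 1 + (if k \<in> J \<and> k \<noteq> 1 then 1 else 0)
     + (if 2 \<in> I \<and> p = vR k then 1 else 0) + (if 1 \<in> J \<and> q = vR k then 1 else 0)"
proof -
  have blocks: "{v \<in> fL ` I \<union> fR ` J. support p q v = vR k} =
    (if k \<in> J \<and> k \<noteq> 1 then {fR k} else {}) \<union> (if 2 \<in> I \<and> p = vR k then {fL 2} else {})
    \<union> (if 1 \<in> J \<and> q = vR k then {fR 1} else {})"
    by (auto split: if_splits)
  show ?thesis unfolding block_size_def blocks by (auto simp: card_insert_if)
qed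

text \<open>The leaves are restricted to index sets \<open>I\<close> and \<open>J\<close> because a
  deletion may split the graph, and each component then takes its own share.\<close>

definition attached :: "two_cat_vertex list \<Rightarrow> nat set \<Rightarrow> nat set \<Rightarrow> two_cat_vertex \<Rightarrow> two_cat_vertex \<Rightarrow> bool" where
  "attached s I J p q \<longleftrightarrow> s \<noteq> [] \<and> distinct s \<and> set s \<subseteq> range vL \<union> range vR \<and> finite I \<and> finite J \<and>
     (\<forall>i\<in>I. i \<noteq> 2 \<longrightarrow> vL i \<in> set s) \<and> (\<forall>j\<in>J. j \<noteq> 1 \<longrightarrow> vR j \<in> set s) \<and> (2 \<in> I \<longrightarrow> p \<in> set s) \<and> (1 \<in> J \<longrightarrow> q \<in> set s)"

lemma Union_caterpillar_edges:
  assumes "attached s I J p q"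
  shows "\<Union>(path_edges s \<union> leaf_edges I J p q) \<subseteq> set s \<union> (fL ` I \<union> fR ` J)"
proof -
  have "\<Union>(leaf_edges I J p q) \<subseteq> set s \<union> (fL ` I \<union> fR ` J)"
    using assms by (auto simp: attached_def leaf_edges_def)
  then show ?thesis using Union_path_edges[of s] by blast
qed

lemma map_upt_const:
  "(\<And>i. a \<le> i \<Longrightarrow> i < b \<Longrightarrow> f i = r) \<Longrightarrow> map f [a..<b] = replicate (b - a) r"
  by (rule nth_equalityI) auto

lemma verts_base:
  "verts (base_graph c) = vL ` {1..<c} \<union> vR ` {1..<c} \<union> (fL ` {1..<c} \<union> fR ` {1..<c})"
proof -
  have "verts (caterpillar (replicate (c - 1) 2)) = (\<lambda>i. (i, 0)) ` {1..<c} \<union> (\<lambda>i. (i, 1)) ` {1..<c}"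
    by (auto simp: caterpillar_def less_2_cases_iff)
  then show ?thesis
    by (simp add: base_graph_def disj_union_def Plus_def image_Un image_image vL_def vR_def fL_def fR_def Un_ac)
qed

lemma edges_base:
  "edges (base_graph c) = path_edges (map vL [1..<c]) \<union> path_edges (map vR [1..<c]) \<union>
     ((\<lambda>i. {vL i, fL i}) ` {1..<c} \<union> (\<lambda>i. {vR i, fR i}) ` {1..<c})"
proof -
  have 1: "{{(i, 0), (i, j)} |i j. 1 \<le> i \<and> i \<le> length (replicate (c - 1) 2) \<and>
       1 \<le> j \<and> j < replicate (c - 1) 2 ! (i - 1)} = (\<lambda>i. {(i, 0), (i, 1 :: nat)}) ` {1..<c}" (is "?A = ?B")
  proof
    show "?A \<subseteq> ?B"
    proof
      fix e assume "e \<in> ?A"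
      then obtain i j where "e = {(i, 0), (i, j)}" "1 \<le> i" "i < c" "1 \<le> j" "j < 2" by auto
      moreover then have "j = 1" by simp
      ultimately show "e \<in> ?B" by simp
    qed
    show "?B \<subseteq> ?A" by fastforce
  qed
  have 2: "{{(i, 0), (i + 1, 0)} |i. 1 \<le> i \<and> i < length (replicate (c - 1) 2)} =
      path_edges (map (\<lambda>i. (i, 0 :: nat)) [1..<c])"
    by (auto simp: path_edges_map_upt)
  have "edges (caterpillar (replicate (c - 1) 2)) =
      path_edges (map (\<lambda>i. (i, 0)) [1..<c]) \<union> (\<lambda>i. {(i, 0), (i, 1)}) ` {1..<c}"
    unfolding caterpillar_def ugraph.simps 1 2 ..
  then show ?thesis
    by (simp add: base_graph_def disj_union_def image_Un image_image path_edges_map[symmetric] comp_def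
        vL_def[abs_def] vR_def[abs_def] fL_def fR_def Un_ac)
qed

context color_weights
begin

lemma csum_attached:
  assumes "attached s I J p q"
  shows "csum (set s \<union> (fL ` I \<union> fR ` J)) (path_edges s \<union> leaf_edges I J p q) = cat_csum (map (block_size I J p q) s)"
  unfolding leaf_edges_eq[symmetric] block_size_def
  by (rule csum_caterpillar) (use assms in \<open>auto simp: attached_def split: if_splits\<close>)

lemma csum_attached_Un:
  assumes "attached s I J p q" "attached s' I' J' p q"
    "set s \<inter> set s' = {}" "I \<inter> I' = {}" "J \<inter> J' = {}"
  shows "csum ((set s \<union> (fL ` I \<union> fR ` J)) \<union> (set s' \<union> (fL ` I' \<union> fR ` J')))
      ((path_edges s \<union> leaf_edges I J p q) \<union> (path_edges s' \<union> leaf_edges I' J' p q)) =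
    cat_csum (map (block_size I J p q) s) * cat_csum (map (block_size I' J' p q) s')"
  unfolding csum_attached[OF assms(1), symmetric] csum_attached[OF assms(2), symmetric]
proof (rule csum_Un)
  have "set s \<subseteq> range vL \<union> range vR" "set s' \<subseteq> range vL \<union> range vR"
    using assms(1,2) by (simp_all add: attached_def)
  then show "(set s \<union> (fL ` I \<union> fR ` J)) \<inter> (set s' \<union> (fL ` I' \<union> fR ` J')) = {}"
    using assms(3-5) by fastforce
  show "finite (set s \<union> (fL ` I \<union> fR ` J))" "finite (set s' \<union> (fL ` I' \<union> fR ` J'))"
    using assms(1,2) by (simp_all add: attached_def)
qed (rule Union_caterpillar_edges assms)+

lemma csum_isolated: "csum {u} {} = cat_csum [1]"
  using csum_caterpillar[of "[u]" "{}"] by simp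

text \<open>A component \<open>fR 1\<close> needs separate treatment, since \<open>attached\<close>
  only admits spines made of the vertices \<open>vL\<close> and \<open>vR\<close>.\<close>

lemma csum_attached_isolated:
  assumes "attached s I J p q" "1 \<notin> J"
  shows "csum ((set s \<union> (fL ` I \<union> fR ` J)) \<union> {fR 1}) (path_edges s \<union> leaf_edges I J p q) =
    cat_csum (map (block_size I J p q) s) * cat_csum [1]"
proof -
  have "set s \<subseteq> range vL \<union> range vR"
    using assms(1) by (simp add: attached_def)
  then have disj: "(set s \<union> (fL ` I \<union> fR ` J)) \<inter> {fR 1} = {}"
    using assms(2) by auto
  have fin: "finite (set s \<union> (fL ` I \<union> fR ` J))" using assms(1) by (simp add: attached_def)
  show ?thesis
    using csum_Un[OF fin _ disj Union_caterpillar_edges[OF assms(1)], of "{}"]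
    by (simp add: csum_attached[OF assms(1)] csum_isolated)
qed

end

section \<open>Edges shared by the graphs\<close>

definition spine_L :: "nat \<Rightarrow> two_cat_vertex list" where "spine_L c = map vL [1..<c]"
definition spine_R :: "nat \<Rightarrow> two_cat_vertex list" where "spine_R c = map vR [1..<c]"

definition pendants :: "nat \<Rightarrow> two_cat_vertex set set" where
  "pendants c = (\<lambda>i. {vL i, fL i}) ` ({1..<c} - {2}) \<union> (\<lambda>i. {vR i, fR i}) ` ({1..<c} - {1})"

text \<open>All four of \<open>G\<close>, \<open>H\<close>, \<open>A\<close>, \<open>B\<close>
  contain \<open>core\<close>. The edge \<open>{vL 1, vL 2}\<close> is left out here because it is
  the one deleted in the second move for \<open>H\<close>.\<close>

definition core_cut :: "nat \<Rightarrow> two_cat_vertex set set" where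
  "core_cut c = path_edges (map vL [2..<c]) \<union> path_edges (spine_R c) \<union> pendants c"

definition core :: "nat \<Rightarrow> two_cat_vertex set set" where
  "core c = path_edges (spine_L c) \<union> path_edges (spine_R c) \<union> pendants c"

lemma core_eq: "3 \<le> c \<Longrightarrow> core c = insert {vL 1, vL 2} (core_cut c)"
  by (simp add: core_def core_cut_def spine_L_def upt_conv_Cons numeral_2_eq_2)

lemma leaf_edges_all:
  "3 \<le> c \<Longrightarrow> leaf_edges {1..<c} {1..<c} p q = pendants c \<union> {{p, fL 2}, {q, fR 1}}"
  by (auto simp: leaf_edges_def pendants_def)

lemma leaf_edges_all_but_one:
  assumes "3 \<le> c"
  shows "leaf_edges {1..<c} {2..<c} p q = pendants c \<union> {{p, fL 2}}"
proof -
  have "{2..<c} - {1} = {1..<c} - {1}" by auto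
  then show ?thesis using assms by (auto simp: leaf_edges_def pendants_def)
qed

lemma edges_base_core: "3 \<le> c \<Longrightarrow> edges (base_graph c) = core c \<union> {{vL 2, fL 2}, {vR 1, fR 1}}"
  unfolding edges_base core_def pendants_def spine_L_def spine_R_def by auto

lemma spine_simps:
  assumes "2 \<le> c"
  shows "last (spine_L c) = vL (c - 1)" "hd (spine_L c) = vL 1" "hd (spine_R c) = vR 1"
    "spine_L c \<noteq> []" "spine_R c \<noteq> []" "distinct (spine_L c)" "distinct (spine_R c)"
    "set (spine_L c) = vL ` {1..<c}" "set (spine_R c) = vR ` {1..<c}"
  using assms by (auto simp: spine_L_def spine_R_def last_map hd_map distinct_map inj_on_def)

context color_weights
begin

section \<open>The forests produced by the moves\<close>

context
  fixes m c :: nat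
  assumes m: "2 \<le> m" and c: "c = m + 2"
begin

lemma c_facts: "3 \<le> c" "2 \<le> c" "c - 1 = m + 1"
  using m c by auto

lemmas sp = spine_simps[OF c_facts(2)]

lemma upt_split:
  "[1..<c] = 1 # 2 # [3..<c]" "[1..<c] = 1 # [2..<c]" "[1..<c] = [1..<m + 1] @ [m + 1]"
  "[2..<c] = [2..<m + 1] @ [m + 1]"
  using m by (simp_all add: c upt_conv_Cons numeral_2_eq_2 numeral_3_eq_3)

lemma map_block_twos:
  assumes "\<And>i. a \<le> i \<Longrightarrow> i < b \<Longrightarrow> block_size I J p q (f i) = 2" "b - a = k"
  shows "map (block_size I J p q) (map f [a..<b]) = twos k"
  unfolding map_map using map_upt_const[of a b "block_size I J p q \<circ> f" 2] assms by (simp del: upt_Suc)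

text \<open>The remainder of the move for \<open>G\<close>: \<open>fL 2\<close> has left
  \<open>vL 2\<close>, whose entry drops to 1, and hangs at \<open>vR 1\<close> together with
  \<open>fR 1\<close>.\<close>

lemma csum_forest_2_1_3:
  "csum (verts (base_graph c)) (core c \<union> {{vR 1, fR 1}, {vL (c - 1), vR 1}, {vR 1, fL 2}}) =
    cat_csum ([2, 1] @ twos (m - 1) @ 3 # twos m)"
proof -
  let ?s = "spine_L c @ spine_R c" and ?b = "block_size {1..<c} {1..<c} (vR 1) (vR 1)"
  have "attached ?s {1..<c} {1..<c} (vR 1) (vR 1)"
    using c_facts(1) by (auto simp: attached_def sp)
  note csum_attached[OF this]
  moreover have "path_edges ?s = insert {vL (c - 1), vR 1} (path_edges (spine_L c) \<union> path_edges (spine_R c))"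
    by (simp add: path_edges_append sp)
  moreover have "map ?b (spine_L c) = [2, 1] @ twos (m - 1)"
  proof -
    have "map ?b (map vL [3..<c]) = twos (m - 1)"
      by (rule map_block_twos) (auto simp: block_size_vL c)
    then show ?thesis unfolding spine_L_def upt_split(1) using c_facts(1) by (simp add: block_size_vL del: map_map)
  qed
  moreover have "map ?b (spine_R c) = 3 # twos m"
  proof -
    have "map ?b (map vR [2..<c]) = twos m"
      by (rule map_block_twos) (auto simp: block_size_vR c)
    then show ?thesis unfolding spine_R_def upt_split(2) using c_facts(1) by (simp add: block_size_vR del: map_map)
  qed
  ultimately show ?thesis
    using leaf_edges_all[OF c_facts(1), of "vR 1" "vR 1"]
    by (simp add: core_def verts_base sp Un_ac insert_commute)
qed

text \<open>This forest and the next two result from the second move for \<open>H\<close>, which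
  carries the edge from \<open>vR 1\<close> to \<open>vL 2\<close> over to \<open>vL 1\<close>. The
  left path is read backwards, as the paths meet at \<open>vL 1\<close>; the other two forests lack
  \<open>{vL 1, vL 2}\<close> and have two components.\<close>

lemma csum_forest_3_1:
  "csum (verts (base_graph c)) (core_cut c \<union> {{vL 1, vL 2}, {vL 1, vR 1}, {vL 2, fL 2}, {vL (c - 1), fR 1}}) =
    cat_csum ([3] @ twos m @ [1] @ twos m)"
proof -
  let ?s = "rev (spine_L c) @ spine_R c" and ?b = "block_size {1..<c} {1..<c} (vL 2) (vL (c - 1))"
  have "attached ?s {1..<c} {1..<c} (vL 2) (vL (c - 1))"
    using c_facts(1) by (auto simp: attached_def sp)
  note csum_attached[OF this]
  moreover have "path_edges ?s = insert {vL 1, vR 1} (path_edges (spine_L c) \<union> path_edges (spine_R c))"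
    by (simp add: path_edges_append path_edges_rev last_rev sp)
  moreover have "map ?b (rev (spine_L c)) = 3 # twos m"
  proof -
    have "map ?b (map vL [1..<m + 1]) = twos m"
      by (rule map_block_twos) (auto simp: block_size_vL c)
    then have "map ?b (spine_L c) = twos m @ [3]"
      unfolding spine_L_def upt_split(3) using m by (simp add: block_size_vL c del: map_map upt_Suc)
    then show ?thesis by (simp add: rev_map[symmetric])
  qed
  moreover have "map ?b (spine_R c) = 1 # twos m"
  proof -
    have "map ?b (map vR [2..<c]) = twos m"
      by (rule map_block_twos) (auto simp: block_size_vR c)
    then show ?thesis unfolding spine_R_def upt_split(2) using c_facts(1) by (simp add: block_size_vR del: map_map)
  qed
  moreover have "core_cut c \<union> {{vL 1, vL 2}, {vL 1, vR 1}, {vL 2, fL 2}, {vL (c - 1), fR 1}} =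
      core c \<union> {{vL 1, vR 1}, {vL 2, fL 2}, {vL (c - 1), fR 1}}"
    by (simp add: core_eq[OF c_facts(1)] insert_commute)
  ultimately show ?thesis
    using leaf_edges_all[OF c_facts(1), of "vL 2" "vL (c - 1)"]
    by (simp add: core_def verts_base sp Un_ac insert_commute)
qed

lemma csum_forest_2_and_3_1:
  "csum (verts (base_graph c)) (core_cut c \<union> {{vL 2, vR 1}, {vL 2, fL 2}, {vL (c - 1), fR 1}}) =
    cat_csum [2] * cat_csum ([3] @ twos (m - 1) @ [1] @ twos m)"
proof -
  let ?s = "rev (map vL [2..<c]) @ spine_R c" and ?b = "block_size {2..<c} {1..<c} (vL 2) (vL (c - 1))"
  have s1: "attached [vL 1] {1} {} (vL 2) (vL (c - 1))"
    by (auto simp: attached_def)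
  have s2: "attached ?s {2..<c} {1..<c} (vL 2) (vL (c - 1))"
    using c_facts(1) by (auto simp: attached_def sp distinct_map inj_on_def)
  have "csum (set [vL 1] \<union> (fL ` {1} \<union> fR ` {}) \<union> (set ?s \<union> (fL ` {2..<c} \<union> fR ` {1..<c})))
      (path_edges [vL 1] \<union> leaf_edges {1} {} (vL 2) (vL (c - 1)) \<union>
      (path_edges ?s \<union> leaf_edges {2..<c} {1..<c} (vL 2) (vL (c - 1)))) =
    cat_csum (map (block_size {1} {} (vL 2) (vL (c - 1))) [vL 1]) * cat_csum (map ?b ?s)"
    by (rule csum_attached_Un[OF s1 s2]) (auto simp: sp)
  moreover have "set [vL 1] \<union> (fL ` {1} \<union> fR ` {}) \<union> (set ?s \<union> (fL ` {2..<c} \<union> fR ` {1..<c})) =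
      verts (base_graph c)"
  proof -
    have "{1..<c} = insert 1 {2..<c}" using c by auto
    then show ?thesis by (auto simp: verts_base sp)
  qed
  moreover have "path_edges ?s = insert {vL 2, vR 1} (path_edges (map vL [2..<c]) \<union> path_edges (spine_R c))"
    using c_facts(1) by (simp add: path_edges_append path_edges_rev last_rev hd_map sp)
  moreover have "leaf_edges {1} {} (vL 2) (vL (c - 1)) \<union> leaf_edges {2..<c} {1..<c} (vL 2) (vL (c - 1)) =
      pendants c \<union> {{vL 2, fL 2}, {vL (c - 1), fR 1}}"
  proof -
    have "{1..<c} - {2} = insert 1 ({2..<c} - {2})" using c by auto
    then show ?thesis using c_facts(1) by (simp add: leaf_edges_def pendants_def Un_ac insert_commute)
  qed
  moreover have "map ?b (rev (map vL [2..<c])) = 3 # twos (m - 1)"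
  proof -
    have "map ?b (map vL [2..<m + 1]) = twos (m - 1)"
      by (rule map_block_twos) (auto simp: block_size_vL c)
    then have "map ?b (map vL [2..<c]) = twos (m - 1) @ [3]"
      unfolding upt_split(4) using m by (simp add: block_size_vL c del: map_map upt_Suc)
    then show ?thesis by (simp add: rev_map[symmetric] del: map_map)
  qed
  moreover have "map ?b (spine_R c) = 1 # twos m"
  proof -
    have "map ?b (map vR [2..<c]) = twos m"
      by (rule map_block_twos) (auto simp: block_size_vR c)
    then show ?thesis unfolding spine_R_def upt_split(2) using c_facts(1) by (simp add: block_size_vR del: map_map)
  qed
  moreover have "map (block_size {1} {} (vL 2) (vL (c - 1))) [vL 1] = [2]"
    by (simp add: block_size_vL)
  ultimately show ?thesis
    by (simp add: core_cut_def Un_ac insert_commute)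
qed

lemma csum_forest_3_and_2_1:
  "csum (verts (base_graph c)) (core_cut c \<union> {{vL 1, vR 1}, {vL 2, fL 2}, {vL (c - 1), fR 1}}) =
    cat_csum ([3] @ twos (m - 1)) * cat_csum ([2, 1] @ twos m)"
proof -
  let ?s = "rev (map vL [2..<c])" and ?b = "block_size {2..<c} {1} (vL 2) (vL (c - 1))"
  let ?s' = "vL 1 # spine_R c" and ?b' = "block_size {1} {2..<c} (vL 2) (vL (c - 1))"
  have s1: "attached ?s {2..<c} {1} (vL 2) (vL (c - 1))"
    using c_facts(1) by (auto simp: attached_def distinct_map inj_on_def)
  have s2: "attached ?s' {1} {2..<c} (vL 2) (vL (c - 1))"
    using c_facts(1) by (auto simp: attached_def sp)
  have "csum (set ?s \<union> (fL ` {2..<c} \<union> fR ` {1}) \<union> (set ?s' \<union> (fL ` {1} \<union> fR ` {2..<c})))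
      (path_edges ?s \<union> leaf_edges {2..<c} {1} (vL 2) (vL (c - 1)) \<union>
      (path_edges ?s' \<union> leaf_edges {1} {2..<c} (vL 2) (vL (c - 1)))) =
    cat_csum (map ?b ?s) * cat_csum (map ?b' ?s')"
    by (rule csum_attached_Un[OF s1 s2]) (auto simp: sp)
  moreover have "set ?s \<union> (fL ` {2..<c} \<union> fR ` {1}) \<union> (set ?s' \<union> (fL ` {1} \<union> fR ` {2..<c})) =
      verts (base_graph c)"
  proof -
    have "{1..<c} = insert 1 {2..<c}" using c by auto
    then show ?thesis by (auto simp: verts_base sp)
  qed
  moreover have "path_edges ?s = path_edges (map vL [2..<c])"
    by (simp add: path_edges_rev)
  moreover have "path_edges ?s' = insert {vL 1, vR 1} (path_edges (spine_R c))"
    using path_edges_append[of "[vL 1]" "spine_R c"] by (simp add: sp)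
  moreover have "leaf_edges {2..<c} {1} (vL 2) (vL (c - 1)) \<union> leaf_edges {1} {2..<c} (vL 2) (vL (c - 1)) =
      pendants c \<union> {{vL 2, fL 2}, {vL (c - 1), fR 1}}"
  proof -
    have "{1..<c} - {2} = insert 1 ({2..<c} - {2})" "{2..<c} - {1} = {1..<c} - {1}" using c by auto
    then show ?thesis using c_facts(1) by (simp add: leaf_edges_def pendants_def Un_ac insert_commute)
  qed
  moreover have "map ?b ?s = 3 # twos (m - 1)"
  proof -
    have "map ?b (map vL [2..<m + 1]) = twos (m - 1)"
      by (rule map_block_twos) (auto simp: block_size_vL c)
    then have "map ?b (map vL [2..<c]) = twos (m - 1) @ [3]"
      unfolding upt_split(4) using m by (simp add: block_size_vL c del: map_map upt_Suc)
    then show ?thesis by (simp add: rev_map[symmetric] del: map_map)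
  qed
  moreover have "map ?b' ?s' = [2, 1] @ twos m"
  proof -
    have "map ?b' (map vR [2..<c]) = twos m"
      by (rule map_block_twos) (auto simp: block_size_vR c)
    then show ?thesis
      unfolding spine_R_def upt_split(2) using c_facts(1) by (simp add: block_size_vR block_size_vL del: map_map)
  qed
  ultimately show ?thesis
    by (simp add: core_cut_def Un_ac insert_commute)
qed

text \<open>In this forest and the next, which result from the third move, \<open>fR 1\<close> has
  lost both its neighbors in \<open>H\<close> and is isolated.\<close>

lemma csum_forest_1_and_1:
  "csum (verts (base_graph c)) (core c \<union> {{vL (c - 1), vR 1}, {vL 2, fL 2}}) =
    cat_csum [1] * cat_csum (twos (m + 1) @ [1] @ twos m)"
proof -
  let ?s = "spine_L c @ spine_R c" and ?b = "block_size {1..<c} {2..<c} (vL 2) (vR 1)"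
  have "attached ?s {1..<c} {2..<c} (vL 2) (vR 1)"
    using c_facts(1) by (auto simp: attached_def sp)
  from csum_attached_isolated[OF this]
  have "csum (set ?s \<union> (fL ` {1..<c} \<union> fR ` {2..<c}) \<union> {fR 1})
    (path_edges ?s \<union> leaf_edges {1..<c} {2..<c} (vL 2) (vR 1)) = cat_csum (map ?b ?s) * cat_csum [1]"
    by simp
  moreover have "set ?s \<union> (fL ` {1..<c} \<union> fR ` {2..<c}) \<union> {fR 1} = verts (base_graph c)"
  proof -
    have "{1..<c} = insert 1 {2..<c}" using c by auto
    then show ?thesis by (auto simp: verts_base sp)
  qed
  moreover have "path_edges ?s = insert {vL (c - 1), vR 1} (path_edges (spine_L c) \<union> path_edges (spine_R c))"
    by (simp add: path_edges_append sp)
  moreover have "map ?b (spine_L c) = twos (m + 1)"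
    unfolding spine_L_def by (rule map_block_twos) (auto simp: block_size_vL c)
  moreover have "map ?b (spine_R c) = 1 # twos m"
  proof -
    have "map ?b (map vR [2..<c]) = twos m"
      by (rule map_block_twos) (auto simp: block_size_vR c)
    then show ?thesis unfolding spine_R_def upt_split(2) using c_facts(1) by (simp add: block_size_vR del: map_map)
  qed
  ultimately show ?thesis
    using leaf_edges_all_but_one[OF c_facts(1), of "vL 2" "vR 1"]
    by (simp add: core_def Un_ac insert_commute mult.commute del: replicate.simps)
qed

lemma csum_forest_1_and_2_1:
  "csum (verts (base_graph c)) (core c \<union> {{vL (c - 1), vR 1}, {vR 1, fL 2}}) =
    cat_csum [1] * cat_csum ([2, 1] @ twos (2 * m))"
proof -
  let ?s = "spine_L c @ spine_R c" and ?b = "block_size {1..<c} {2..<c} (vR 1) (vR 1)"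
  have "attached ?s {1..<c} {2..<c} (vR 1) (vR 1)"
    using c_facts(1) by (auto simp: attached_def sp)
  from csum_attached_isolated[OF this]
  have "csum (set ?s \<union> (fL ` {1..<c} \<union> fR ` {2..<c}) \<union> {fR 1})
    (path_edges ?s \<union> leaf_edges {1..<c} {2..<c} (vR 1) (vR 1)) = cat_csum (map ?b ?s) * cat_csum [1]"
    by simp
  moreover have "set ?s \<union> (fL ` {1..<c} \<union> fR ` {2..<c}) \<union> {fR 1} = verts (base_graph c)"
  proof -
    have "{1..<c} = insert 1 {2..<c}" using c by auto
    then show ?thesis by (auto simp: verts_base sp)
  qed
  moreover have "path_edges ?s = insert {vL (c - 1), vR 1} (path_edges (spine_L c) \<union> path_edges (spine_R c))"
    by (simp add: path_edges_append sp)
  moreover have "map ?b ?s = [2, 1] @ twos (2 * m)"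
  proof -
    have "map ?b (spine_L c) = [2, 1] @ twos (m - 1)"
    proof -
      have "map ?b (map vL [3..<c]) = twos (m - 1)"
        by (rule map_block_twos) (auto simp: block_size_vL c)
      then show ?thesis unfolding spine_L_def upt_split(1) using c_facts(1) by (simp add: block_size_vL del: map_map)
    qed
    moreover have "map ?b (spine_R c) = twos (m + 1)"
      unfolding spine_R_def by (rule map_block_twos) (use m in \<open>auto simp: block_size_vR c\<close>)
    moreover have "m - 1 + (m + 1) = 2 * m" using m by simp
    ultimately show ?thesis by (simp only: map_append append_assoc replicate_add[symmetric])
  qed
  ultimately show ?thesis
    using leaf_edges_all_but_one[OF c_facts(1), of "vR 1" "vR 1"]
    by (simp add: core_def Un_ac insert_commute mult.commute)
qed

end
end

section \<open>Expansion of both graphs\<close>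

lemma new_vertices_not_in_core: "fL 2 \<notin> \<Union>(core c)" "fR 1 \<notin> \<Union>(core c)"
proof -
  have "{fL 2, fR 1} \<inter> \<Union>(path_edges (spine_L c)) = {}" "{fL 2, fR 1} \<inter> \<Union>(path_edges (spine_R c)) = {}"
    using Union_path_edges[of "spine_L c"] Union_path_edges[of "spine_R c"]
    by (auto simp: spine_L_def spine_R_def)
  moreover have "{fL 2, fR 1} \<inter> \<Union>(pendants c) = {}" by (auto simp: pendants_def)
  ultimately show "fL 2 \<notin> \<Union>(core c)" "fR 1 \<notin> \<Union>(core c)" unfolding core_def by blast+
qed

lemma special_graphs:
  assumes "3 \<le> c"
  shows "verts (G_graph c) = verts (base_graph c)" "verts (H_graph c) = verts (base_graph c)"
    "verts (A_graph c) = verts (base_graph c)" "verts (B_graph c) = verts (base_graph c)"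
    "edges (G_graph c) = core c \<union> {{vL 2, fL 2}, {vR 1, fR 1}, {vL (c - 1), vR 1}, {fL 2, vR 1}}"
    "edges (H_graph c) = core c \<union> {{vL 2, fL 2}, {vR 1, fR 1}, {vL (c - 1), fR 1}, {vL 2, vR 1}}"
    "edges (A_graph c) = core c \<union> {{vL 2, fL 2}, {vR 1, fR 1}, {vL (c - 1), vR 1}, {vL 2, vR 1}}"
    "edges (B_graph c) = core c \<union> {{vR 1, fR 1}, {vL (c - 1), vR 1}, {vL 2, vR 1}}"
proof -
  show "verts (G_graph c) = verts (base_graph c)" "verts (H_graph c) = verts (base_graph c)"
    "verts (A_graph c) = verts (base_graph c)" "verts (B_graph c) = verts (base_graph c)"
    by (simp_all add: G_graph_def H_graph_def A_graph_def B_graph_def add_edges_def del_edge_def)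
  show "edges (G_graph c) = core c \<union> {{vL 2, fL 2}, {vR 1, fR 1}, {vL (c - 1), vR 1}, {fL 2, vR 1}}"
    "edges (H_graph c) = core c \<union> {{vL 2, fL 2}, {vR 1, fR 1}, {vL (c - 1), fR 1}, {vL 2, vR 1}}"
    and A: "edges (A_graph c) = core c \<union> {{vL 2, fL 2}, {vR 1, fR 1}, {vL (c - 1), vR 1}, {vL 2, vR 1}}"
    by (simp_all add: G_graph_def H_graph_def A_graph_def add_edges_def edges_base_core[OF assms] insert_commute)
  have "{vL 2, fL 2} \<notin> core c \<union> {{vR 1, fR 1}, {vL (c - 1), vR 1}, {vL 2, vR 1}}"
    using new_vertices_not_in_core(1)[of c] by (auto simp: doubleton_eq_iff)
  then show "edges (B_graph c) = core c \<union> {{vR 1, fR 1}, {vL (c - 1), vR 1}, {vL 2, vR 1}}"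
    unfolding B_graph_def del_edge_def A ugraph.simps by blast
qed

context color_weights
begin

definition graph_csum :: "'a ugraph \<Rightarrow> 'r" where "graph_csum G = csum (verts G) (edges G)"

text \<open>The transposition of \<open>fL 2\<close> and \<open>fR 1\<close> fixes \<open>F\<close>,
  which avoids both. It is needed because \<open>fL 2\<close> is isolated in \<open>B\<close>, while
  the third move leaves \<open>fR 1\<close> isolated.\<close>

lemma csum_swap_leaves:
  assumes "3 \<le> c" and fin: "fL 2 \<notin> \<Union>F" "fR 1 \<notin> \<Union>F" "\<Union>F \<subseteq> verts (base_graph c)"
    and u: "u \<in> verts (base_graph c)" "u \<noteq> fL 2" "u \<noteq> fR 1"
  shows "csum (verts (base_graph c)) (F \<union> {{u, fL 2}}) = csum (verts (base_graph c)) (F \<union> {{u, fR 1}})"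
proof -
  let ?V = "verts (base_graph c)"
  define f where "f = id(fL 2 := fR 1, fR 1 := fL 2)"
  have mem: "fL 2 \<in> ?V" "fR 1 \<in> ?V" using assms(1) by (auto simp: verts_base)
  have ff: "f (f v) = v" for v by (auto simp: f_def)
  then have inj: "inj_on f ?V" by (metis inj_onI)
  have "f ` ?V \<subseteq> ?V" using mem by (auto simp: f_def)
  then have img: "f ` ?V = ?V" using ff by (metis image_eqI subsetI subset_antisym subsetD)
  have "f ` e = e" if "e \<in> F" for e
  proof -
    have "f v = v" if "v \<in> e" for v using that \<open>e \<in> F\<close> fin by (auto simp: f_def)
    then show ?thesis by force
  qed
  then have "(`) f ` F = F" by force
  moreover have "f ` {u, fL 2} = {u, fR 1}" using u by (auto simp: f_def)
  ultimately have "(`) f ` (F \<union> {{u, fL 2}}) = F \<union> {{u, fR 1}}" by (simp add: image_Un)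
  then show ?thesis
    using csum_image[OF inj, of "F \<union> {{u, fL 2}}"] img fin u mem by simp
qed

context
  fixes c :: nat
  assumes c: "4 \<le> c"
begin

text \<open>The edge from \<open>vR 1\<close> to \<open>fL 2\<close> is moved to
  \<open>vL 2\<close>, which turns \<open>G\<close> into \<open>A\<close>; the deleted edge
  \<open>{vL 2, fL 2}\<close> is the one by which \<open>A\<close> and \<open>B\<close>
  differ.\<close>

lemma graph_csum_G: "graph_csum (G_graph c) = graph_csum (A_graph c) - graph_csum (B_graph c) + cat_csum ([2, 1] @ twos (c - 3) @ 3 # twos (c - 2))"
  using csum_triangle[of "verts (base_graph c)" "core c \<union> {{vR 1, fR 1}, {vL (c - 1), vR 1}}" "vR 1" "fL 2" "vL 2"]
    csum_forest_2_1_3[of "c - 2" c] c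
  by (simp add: graph_csum_def special_graphs insert_commute)

text \<open>
  \<open>P\<close> and \<open>Q\<close> are \<open>H\<close> without the edge \<open>{fR 1, vR 1}\<close> and \<open>A\<close> without \<open>{fR 1, vR 1}\<close>. A second move
  turns \<open>P\<close> into caterpillars, and a third one turns \<open>Q\<close> into \<open>B\<close> up to swapping \<open>fL 2\<close> and \<open>fR 1\<close>.
\<close>

lemma graph_csum_H: "graph_csum (H_graph c) = graph_csum (A_graph c) - graph_csum (B_graph c) + cat_csum ([2, 1] @ twos (c - 3) @ 3 # twos (c - 2))"
proof -
  let ?V = "verts (base_graph c)" and ?n = "c - 1" and ?m = "c - 2"
  define P where "P = csum ?V (core c \<union> {{vL 2, fL 2}, {vL 2, vR 1}, {vL ?n, fR 1}})"
  define Q where "Q = csum ?V (core c \<union> {{vL 2, fL 2}, {vL 2, vR 1}, {vL ?n, vR 1}})"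
  have c3: "3 \<le> c" and m: "2 \<le> ?m" "c = ?m + 2" using c by auto
  have H: "graph_csum (H_graph c) = graph_csum (A_graph c) + P - Q"
    using csum_triangle[of ?V "core c \<union> {{vL 2, fL 2}, {vL 2, vR 1}}" "vL ?n" "fR 1" "vR 1"]
    by (simp add: graph_csum_def special_graphs[OF c3] P_def Q_def insert_commute)
  have P: "P = cat_csum ([3] @ twos ?m @ [1] @ twos ?m) + cat_csum [2] * cat_csum ([3] @ twos (?m - 1) @ [1] @ twos ?m)
      - cat_csum ([3] @ twos (?m - 1)) * cat_csum ([2, 1] @ twos ?m)"
    unfolding csum_forest_3_1[OF m, symmetric] csum_forest_2_and_3_1[OF m, symmetric] csum_forest_3_and_2_1[OF m, symmetric] P_def core_eq[OF c3]
    using csum_triangle[of ?V "core_cut c \<union> {{vL 2, fL 2}, {vL ?n, fR 1}}" "vR 1" "vL 2" "vL 1"]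
    by (simp add: insert_commute)
  have "csum ?V ((core c \<union> {{vL ?n, vR 1}, {vL 2, vR 1}}) \<union> {{vR 1, fL 2}}) =
      csum ?V ((core c \<union> {{vL ?n, vR 1}, {vL 2, vR 1}}) \<union> {{vR 1, fR 1}})"
  proof (rule csum_swap_leaves[OF c3])
    have "fin_simple_graph (base_graph c)"
      unfolding base_graph_def by (intro fin_simple_graph_disj_union fin_simple_graph_caterpillar) auto
    then have "\<Union>(core c) \<subseteq> ?V"
      using edges_base_core[OF c3] by (auto simp: fin_simple_graph_def)
    then show "\<Union>(core c \<union> {{vL ?n, vR 1}, {vL 2, vR 1}}) \<subseteq> ?V"
      using c by (auto simp: verts_base)
  qed (use c new_vertices_not_in_core in \<open>auto simp: verts_base\<close>)
  then have B: "csum ?V (core c \<union> {{vL ?n, vR 1}, {vL 2, vR 1}, {vR 1, fL 2}}) = graph_csum (B_graph c)"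
    by (simp add: graph_csum_def special_graphs[OF c3] insert_commute)
  have Q: "Q = graph_csum (B_graph c) + cat_csum [1] * cat_csum (twos (?m + 1) @ [1] @ twos ?m) - cat_csum [1] * cat_csum ([2, 1] @ twos (2 * ?m))"
    unfolding csum_forest_1_and_1[OF m, symmetric] csum_forest_1_and_2_1[OF m, symmetric] B[symmetric] Q_def
    using csum_triangle[of ?V "core c \<union> {{vL ?n, vR 1}}" "fL 2" "vL 2" "vR 1"]
    by (simp add: insert_commute)
  have "?m - 1 = c - 3" by simp
  \<comment> \<open>Once \<open>B\<close> is split off from \<open>Q\<close>, the caterpillar terms
    of \<open>P - Q\<close> are exactly the right-hand side of the double slide.\<close>
  then show ?thesis
    using cat_csum_double_slide[OF m(1)] unfolding H P Q by (simp add: algebra_simps)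
qed

lemma graph_csum_expansion:
  "graph_csum (A_graph c) - graph_csum (B_graph c) + cat_csum ([2, 1] @ twos (c - 3) @ 3 # twos (c - 2)) =
    graph_csum (A_graph c) - graph_csum (B_graph c) + graph_csum (T_graph c) - graph_csum (S_graph c) + graph_csum (F_graph c)
      + (\<Sum>i = 1..c - 4.
          graph_csum (caterpillar (twos i @ [3]) \<squnion>\<^sub>g caterpillar (twos (c - 3 - i) @ [3] @ twos (c - 2)))
        - graph_csum (caterpillar (twos (i + 1)) \<squnion>\<^sub>g caterpillar ([3] @ twos (c - 4 - i) @ [3] @ twos (c - 2))))"
proof -
  have T: "graph_csum (T_graph c) = cat_csum (twos (c - 2) @ [1, 3] @ twos (c - 2))"
    unfolding T_graph_def graph_csum_def by (rule csum_cat) auto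
  have S: "graph_csum (S_graph c) = cat_csum (twos (c - 2)) * cat_csum ([4] @ twos (c - 2))"
    unfolding S_graph_def graph_csum_def by (rule csum_two_cats) (use c in auto)
  have F: "graph_csum (F_graph c) = cat_csum [3] * cat_csum (twos (c - 3) @ [3] @ twos (c - 2))"
    unfolding F_graph_def graph_csum_def by (rule csum_two_cats) auto
  have D: "graph_csum (caterpillar (twos i @ [3]) \<squnion>\<^sub>g caterpillar (twos (c - 3 - i) @ [3] @ twos (c - 2))) =
      cat_csum (twos i @ [3]) * cat_csum (twos (c - 3 - i) @ [3] @ twos (c - 2))" for i
    unfolding graph_csum_def by (rule csum_two_cats) auto
  have E: "graph_csum (caterpillar (twos (i + 1)) \<squnion>\<^sub>g caterpillar ([3] @ twos (c - 4 - i) @ [3] @ twos (c - 2))) =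
      cat_csum (twos (i + 1)) * cat_csum ([3] @ twos (c - 4 - i) @ [3] @ twos (c - 2))" for i
    unfolding graph_csum_def by (rule csum_two_cats) auto
  have m: "2 \<le> c - 2" and "c - 2 - 1 = c - 3" "c - 2 - 2 = c - 4" using c by auto
  then show ?thesis
    using cat_csum_shift_1_to_3[OF m] unfolding T S F D E by (simp add: algebra_simps)
qed

end
end

lemma sum_fun_apply: "(\<Sum>i\<in>A. f i) m = (\<Sum>i\<in>A. f i m)"
  by (induction A rule: infinite_finite_induct) auto

theorem theorem4p13:
  fixes c :: nat
  assumes "c \<ge> 4"
  shows "csf (H_graph c) =
           csf (A_graph c) - csf (B_graph c) + csf (T_graph c) - csf (S_graph c) + csf (F_graph c)
           + (\<Sum>i = 1..c - 4.
                csf (caterpillar (replicate i 2 @ [3]) \<squnion>\<^sub>g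
                     caterpillar (replicate (c - 3 - i) 2 @ [3] @ replicate (c - 2) 2))
              - csf (caterpillar (replicate (i + 1) 2) \<squnion>\<^sub>g
                     caterpillar ([3] @ replicate (c - 4 - i) 2 @ [3] @ replicate (c - 2) 2)))
         \<and> csf (G_graph c) = csf (H_graph c)"
proof (intro conjI ext)
  fix m :: "nat multiset"
  \<comment> \<open>The bound on the colors depends on the coefficient under consideration, so the
    ring identities are applied anew for each monomial.\<close>
  obtain N where N: "set_mset m \<subseteq> {..<N}"
    using finite_nat_set_iff_bounded[of "set_mset m"] by auto
  interpret color_weights "{..<N}" color_var by unfold_locales simp
  have csf: "csf G m = Poly_Mapping.lookup (graph_csum G) m" if "fin_simple_graph G" for G :: "'a ugraph"
    using csf_eq_lookup_W[of G, OF _ N] that by (simp add: graph_csum_def fin_simple_graph_def)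
  have cats: "fin_simple_graph (caterpillar \<alpha> \<squnion>\<^sub>g caterpillar \<beta>)"
    if "0 \<notin> set \<alpha>" "0 \<notin> set \<beta>" for \<alpha> \<beta>
    using that by (intro fin_simple_graph_disj_union fin_simple_graph_caterpillar)
      (auto simp: Suc_le_eq intro!: gr0I)
  show "csf (G_graph c) m = csf (H_graph c) m"
    by (simp add: csf fin_simple_graph_special[OF assms] graph_csum_G[OF assms] graph_csum_H[OF assms])
  show "csf (H_graph c) m =
           (csf (A_graph c) - csf (B_graph c) + csf (T_graph c) - csf (S_graph c) + csf (F_graph c)
           + (\<Sum>i = 1..c - 4.
                csf (caterpillar (replicate i 2 @ [3]) \<squnion>\<^sub>g
                     caterpillar (replicate (c - 3 - i) 2 @ [3] @ replicate (c - 2) 2))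
              - csf (caterpillar (replicate (i + 1) 2) \<squnion>\<^sub>g
                     caterpillar ([3] @ replicate (c - 4 - i) 2 @ [3] @ replicate (c - 2) 2)))) m"
    using graph_csum_H[OF assms, unfolded graph_csum_expansion[OF assms]]
    by (simp add: sum_fun_apply csf fin_simple_graph_special[OF assms] cats lookup_add lookup_minus lookup_sum)
qed

end
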